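(* Let $\gamma_1,\dots,\gamma_d$ be $d$ disjoint pieces of smooth analytic hypersurface in $\mathbb C^n$. Suppose that for any $(\alpha,\beta)\in(\mathbb C^{n-1})^2$ close to $(0,0)$, the affine line $$L_{\alpha,\beta}:=\{\zeta\in\mathbb C^n:\ \zeta_k=\alpha_k\zeta_n+\beta_k,\ k=1,\dots,n-1\}$$ intersects $\gamma_1,\dots,\gamma_d$ transversally, respectively at points $p_1(\alpha,\beta),\dots,p_d(\alpha,\beta)$. Assume that there exist $D\in\mathbb N$ and analytic functions $h_{\underline k}$ ($\underline k\in\mathbb N^{n-1}$, $|\underline k|\le D+1$) in a neighborhood of $0$ in $\mathbb C^{n-1}$, with at least one of the $h_{\underline k}$, $|\underline k|=D+1$, not identically zero, such that for $(\alpha,\beta)$ close to $(0,0)$ in $(\mathbb C^{n-1})^2$, $$\sum_{j=1}^d\zeta_n[p_j(\alpha,\beta)]=\sum_{\substack{\underline k\in\mathbb N^{n-1}\\|\underline k|\le D+1}}h_{\underline k}(\alpha)\,\beta_1^{k_1}\cdots\beta_{n-1}^{k_{n-1}} .$$ Then one can find a polynomial $P\in\mathbb C[X_1,\dots,X_n]$ of degree $d+D$, with zero set $V(P)\subset\mathbb C^n$, and constants $\epsilon>0$, $\kappa>0$, $K>0$ such that: (i) if $\Gamma_\epsilon:=\bigcup_{\max(\|\alpha\|,\|\beta\|)<\epsilon}L_{\alpha,\beta}$ (union over $(\alpha,\beta)\in(\mathbb C^{n-1})^2$), then $$\zeta\in\Gamma_\epsilon,\ \|\zeta\|\ge K\ \Longrightarrow\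 |P(\zeta)|\ge\kappa\|\zeta\|^d;$$ (ii) for $\max(\|\alpha\|,\|\beta\|)<\epsilon$, $\ L_{\alpha,\beta}\cap V(P)=\{p_1(\alpha,\beta),\dots,p_d(\alpha,\beta)\}$.
   Context: $n\ge2$. A "piece of smooth analytic hypersurface" is a (germ-like, small) locally closed complex submanifold of $\mathbb C^n$ of codimension one. For a point $p\in\mathbb C^n$, $\zeta_n[p]$ denotes its $n$-th affine coordinate. For a multi-index $\underline k$, $|\underline k|=\sum k_i$. *)

theory Defs
  imports "HOL-Analysis.Analysis" "HOL-Library.Poly_Mapping" "HOL-Library.Disjoint_Sets"
begin

text \<open>
  The index set of \<open>\<complex>\<close>-coordinates is \<open>'m option\<close>: \<open>Some k\<close> for \<open>k :: 'm\<close> stands for the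
  coordinates \<open>1, \<dots>, n - 1\<close> and \<open>None\<close> for the \<open>n\<close>-th one.  So \<open>n = CARD('m) + 1 \<ge> 2\<close>, the
  space \<open>\<complex>\<^sup>n\<close> is \<open>complex ^ 'm option\<close>, and \<open>\<complex>\<^sup>n\<^sup>-\<^sup>1\<close> is \<open>complex ^ 'm\<close>.
\<close>

text \<open>
  Analytic functions of several complex variables, as for the one-variable \<open>holomorphic_on\<close>:
  at each point of an open set there is a \<open>\<complex>\<close>-linear Frechet derivative.
\<close>

definition mv_holomorphic_on :: "(complex ^ 'n \<Rightarrow> complex) \<Rightarrow> (complex ^ 'n) set \<Rightarrow> bool"
  where "mv_holomorphic_on f U \<longleftrightarrow>
    open U \<and> (\<forall>z\<in>U. \<exists>f'. (f has_derivative f') (at z) \<and> (\<forall>c v. f' (c *s v) = c * f' v))"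

text \<open>
  Submanifolds of codimension one, given by local equations with nonvanishing differential.  Such
  a set is automatically locally closed.
\<close>

definition smooth_hypersurface :: "(complex ^ 'n) set \<Rightarrow> bool"
  where "smooth_hypersurface S \<longleftrightarrow>
    (\<forall>p\<in>S. \<exists>V f. open V \<and> p \<in> V \<and> mv_holomorphic_on f V \<and>
       frechet_derivative f (at p) \<noteq> (\<lambda>v. 0) \<and> S \<inter> V = {z \<in> V. f z = 0})"

text \<open>
  Velocities at \<open>p\<close> of curves in \<open>S\<close>.  If \<open>S\<close> is a complex submanifold, this real tangent space
  coincides with the complex one as a subset of the ambient space.
\<close>

definition tangent_space :: "'a::real_normed_vector set \<Rightarrow> 'a \<Rightarrow> 'a set"
  where "tangent_space S p =
    {v. \<exists>c :: real \<Rightarrow> 'a. c 0 = p \<and> (\<forall>\<^sub>F t in nhds 0. c t \<in> S) \<and>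
          (c has_vector_derivative v) (at 0)}"

definition transversal_at :: "'a::real_normed_vector set \<Rightarrow> 'a set \<Rightarrow> 'a \<Rightarrow> bool"
  where "transversal_at S T p \<longleftrightarrow>
    p \<in> S \<inter> T \<and> {u + v |u v. u \<in> tangent_space S p \<and> v \<in> tangent_space T p} = UNIV"

definition affine_line :: "complex ^ ('m::finite) \<Rightarrow> complex ^ 'm \<Rightarrow> (complex ^ 'm option) set"
  where "affine_line \<alpha> \<beta> = {\<zeta>. \<forall>k. \<zeta> $ Some k = \<alpha> $ k * \<zeta> $ None + \<beta> $ k}"

definition line_tube :: "real \<Rightarrow> (complex ^ ('m::finite) option) set"
  where "line_tube \<epsilon> =
    (\<Union>(\<alpha>, \<beta>) \<in> {(\<alpha> :: complex ^ 'm, \<beta>). max (norm \<alpha>) (norm \<beta>) < \<epsilon>}. affine_line \<alpha> \<beta>)"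

text \<open>
  A polynomial with variables indexed by \<open>'v\<close> is a finitely supported family of coefficients
  indexed by exponents, themselves finitely supported.
\<close>

type_synonym 'v cpoly = "('v \<Rightarrow>\<^sub>0 nat) \<Rightarrow>\<^sub>0 complex"

definition cpoly_eval :: "'v::finite cpoly \<Rightarrow> complex ^ 'v \<Rightarrow> complex"
  where "cpoly_eval P z =
    (\<Sum>m\<in>Poly_Mapping.keys P.
       Poly_Mapping.lookup P m * (\<Prod>i\<in>UNIV. (z $ i) ^ Poly_Mapping.lookup m i))"

text \<open>Total degree; the zero polynomial gets degree \<open>0\<close>.\<close>

definition cpoly_degree :: "'v::finite cpoly \<Rightarrow> nat"
  where "cpoly_degree P =
    Max (insert 0 ((\<lambda>m. \<Sum>i\<in>UNIV. Poly_Mapping.lookup m i) ` Poly_Mapping.keys P))"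

definition zero_set :: "'v::finite cpoly \<Rightarrow> (complex ^ 'v) set"
  where "zero_set P = {z. cpoly_eval P z = 0}"

definition multi_indices_le :: "nat \<Rightarrow> ('m::finite \<Rightarrow> nat) set"
  where "multi_indices_le N = {k. (\<Sum>i\<in>UNIV. k i) \<le> N}"

text \<open>Sums over these index sets are genuine finite sums.\<close>

lemma finite_multi_indices_le: "finite (multi_indices_le N :: ('m::finite \<Rightarrow> nat) set)"
proof (rule finite_subset)
  show "multi_indices_le N \<subseteq> (UNIV :: 'm set) \<rightarrow>\<^sub>E {..N}"
  proof
    fix k :: "'m \<Rightarrow> nat"
    assume k: "k \<in> multi_indices_le N"
    have "k i \<le> N" for i
      using member_le_sum[of i UNIV k] k by (simp add: multi_indices_le_def)
    then show "k \<in> (UNIV :: 'm set) \<rightarrow>\<^sub>E {..N}" by (auto simp: PiE_def)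
  qed
  show "finite ((UNIV :: 'm set) \<rightarrow>\<^sub>E {..N})" by (rule finite_PiE) auto
qed

end

theory Submission
  imports Defs "HOL-Complex_Analysis.Conformal_Mappings"
begin

text \<open>
  Let \<open>z\<^sub>j(\<alpha>, \<beta>)\<close> be the last coordinate of \<open>p\<^sub>j(\<alpha>, \<beta>)\<close>.  Transversality makes it differentiable,
  with \<open>\<partial>z\<^sub>j/\<partial>\<alpha>\<^sub>k = z\<^sub>j \<partial>z\<^sub>j/\<partial>\<beta>\<^sub>k\<close>.  Hence the elementary symmetric functions \<open>e\<^sub>i\<close> of the \<open>z\<^sub>j\<close> satisfy
  \<open>\<partial>e\<^sub>i\<^sub>+\<^sub>1/\<partial>\<beta>\<^sub>k = e\<^sub>i \<partial>e\<^sub>1/\<partial>\<beta>\<^sub>k - \<partial>e\<^sub>i/\<partial>\<alpha>\<^sub>k\<close>, and since \<open>e\<^sub>1\<close> is polynomial in \<open>\<beta>\<close> of degree \<open>D + 1\<close>,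
  every \<open>e\<^sub>i\<close> is polynomial in \<open>\<beta>\<close> of degree at most \<open>i (D + 1)\<close>.  For the last \<open>e\<^sub>i\<close> that is not zero the
  relation reads \<open>\<partial>e\<^sub>i/\<partial>\<alpha>\<^sub>k = e\<^sub>i \<partial>e\<^sub>1/\<partial>\<beta>\<^sub>k\<close>; comparing degrees in \<open>\<beta>\<close> shows that the hypotheses force
  \<open>D = 0\<close>.  Then \<open>P(\<zeta>', \<zeta>\<^sub>n) = \<Prod>\<^sub>j (\<zeta>\<^sub>n - z\<^sub>j(0, \<zeta>'))\<close> is a polynomial of degree \<open>d\<close>.  It vanishes at
  every \<open>p\<^sub>j(\<alpha>, \<beta>)\<close>, because that point also lies on the line with \<open>\<alpha> = 0\<close> through it.  On a line it is
  therefore \<open>c(\<alpha>) \<Prod>\<^sub>j (\<zeta>\<^sub>n - z\<^sub>j(\<alpha>, \<beta>))\<close>, where \<open>c\<close> is continuous and \<open>c(0) = 1\<close>.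
\<close>

section \<open>Homogeneous forms and interpolation\<close>

definition vmonom :: "('n::finite \<Rightarrow> nat) \<Rightarrow> complex ^ 'n \<Rightarrow> complex"
  where "vmonom k x = (\<Prod>i\<in>UNIV. (x $ i) ^ k i)"

definition exponents :: "nat \<Rightarrow> ('n::finite \<Rightarrow> nat) set"
  where "exponents m = {k. (\<Sum>i\<in>UNIV. k i) = m}"

text \<open>Forms are functions rather than formal polynomials: closure properties then only need
  the existence of coefficients, and the zero function is a form of every degree.\<close>

definition hform :: "nat \<Rightarrow> (complex ^ 'n::finite \<Rightarrow> complex) \<Rightarrow> bool"
  where "hform m Q \<longleftrightarrow> (\<exists>c. \<forall>x. Q x = (\<Sum>k\<in>exponents m. c k * vmonom k x))"

lemma finite_exponents: "finite (exponents m :: ('n::finite \<Rightarrow> nat) set)"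
  by (rule finite_subset[OF _ finite_multi_indices_le[of m]])
     (auto simp: exponents_def multi_indices_le_def)

lemma multi_indices_le_eq: "multi_indices_le N = (\<Union>m\<le>N. exponents m)"
  by (auto simp: exponents_def multi_indices_le_def)

lemma sum_multi_indices_le:
  fixes g :: "('n::finite \<Rightarrow> nat) \<Rightarrow> 'b::comm_monoid_add"
  shows "(\<Sum>k\<in>multi_indices_le N. g k) = (\<Sum>m\<le>N. \<Sum>k\<in>exponents m. g k)"
  unfolding multi_indices_le_eq
  by (subst sum.UNION_disjoint) (auto simp: finite_exponents, auto simp: exponents_def)

lemma vmonom_smult: "vmonom k (c *s x) = c ^ (\<Sum>i\<in>UNIV. k i) * vmonom k x"
  by (simp add: vmonom_def power_mult_distrib prod.distrib power_sum)

lemma hform_smult: "hform m Q \<Longrightarrow> Q (c *s x) = c ^ m * Q x"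
  unfolding hform_def
  by (auto simp: vmonom_smult sum_distrib_left exponents_def intro!: sum.cong)

lemma hform_zero: "hform m (\<lambda>x. 0)"
  unfolding hform_def by (rule exI[of _ "\<lambda>k. 0"]) simp

lemma hform_add:
  assumes "hform m P" "hform m Q"
  shows "hform m (\<lambda>x. P x + Q x)"
proof -
  obtain a b where "\<forall>x. P x = (\<Sum>k\<in>exponents m. a k * vmonom k x)"
    "\<forall>x. Q x = (\<Sum>k\<in>exponents m. b k * vmonom k x)"
    using assms unfolding hform_def by blast
  then show ?thesis unfolding hform_def
    by (intro exI[of _ "\<lambda>k. a k + b k"]) (simp add: distrib_right sum.distrib)
qed

lemma hform_cmult: "hform m P \<Longrightarrow> hform m (\<lambda>x. a * P x)"
proof -
  assume "hform m P"
  then obtain c where "\<forall>x. P x = (\<Sum>k\<in>exponents m. c k * vmonom k x)"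
    by (auto simp: hform_def)
  then show ?thesis unfolding hform_def
    by (intro exI[of _ "\<lambda>k. a * c k"]) (simp add: sum_distrib_left mult.assoc)
qed

lemma hform_sum: "(\<And>i. i \<in> I \<Longrightarrow> hform m (P i)) \<Longrightarrow> hform m (\<lambda>x. \<Sum>i\<in>I. P i x)"
  by (induction I rule: infinite_finite_induct) (simp_all add: hform_zero hform_add)

lemma hform_vmonom: "hform (\<Sum>i\<in>UNIV. k i) (vmonom k)"
  unfolding hform_def
proof (intro exI allI)
  fix x :: "complex ^ 'a"
  show "vmonom k x = (\<Sum>k'\<in>exponents (\<Sum>i\<in>UNIV. k i). (if k' = k then 1 else 0) * vmonom k' x)"
    by (simp add: if_distrib[of "\<lambda>a. a * _"] sum.delta finite_exponents cong: if_cong)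
      (simp add: exponents_def)
qed

lemma hform_const: "hform 0 (\<lambda>x. a)"
  using hform_cmult[OF hform_vmonom[of "\<lambda>_. 0"], of a] by (simp add: vmonom_def)

lemma hform_component: "hform 1 (\<lambda>x. x $ i)"
proof -
  have "vmonom (\<lambda>j. if j = i then 1 else 0) = (\<lambda>x. x $ i)"
    by (rule ext) (simp add: vmonom_def if_distrib[of "\<lambda>n. _ ^ n"] prod.delta cong: if_cong)
  then show ?thesis using hform_vmonom[of "\<lambda>j. if j = i then 1 else 0"] by simp
qed

lemma hform_mult:
  assumes "hform m P" "hform n Q"
  shows "hform (m + n) (\<lambda>x. P x * Q x)"
proof -
  obtain a b where a: "\<And>x. P x = (\<Sum>k\<in>exponents m. a k * vmonom k x)"
    and b: "\<And>x. Q x = (\<Sum>l\<in>exponents n. b l * vmonom l x)"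
    using assms by (auto simp: hform_def)
  have eq: "P x * Q x = (\<Sum>k\<in>exponents m. \<Sum>l\<in>exponents n. (a k * b l) * vmonom (\<lambda>i. k i + l i) x)" for x
    unfolding a b sum_product
    by (simp add: vmonom_def power_add prod.distrib algebra_simps)
  have "hform (m + n) (vmonom (\<lambda>i. k i + l i))" if "k \<in> exponents m" "l \<in> exponents n" for k l
    using that hform_vmonom[of "\<lambda>i. k i + l i"] by (simp add: exponents_def sum.distrib)
  then show ?thesis unfolding eq by (intro hform_sum hform_cmult)
qed

lemma hform_zero_at_0: "hform m Q \<Longrightarrow> m > 0 \<Longrightarrow> Q 0 = 0"
  using hform_smult[of m Q 0 0] by (simp add: power_0_left)

lemma continuous_on_hform: "hform m Q \<Longrightarrow> continuous_on S Q"
proof -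
  assume "hform m Q"
  then obtain c where "Q = (\<lambda>x. \<Sum>k\<in>exponents m. c k * vmonom k x)"
    by (auto simp: hform_def)
  then show ?thesis
    unfolding vmonom_def
    by (safe intro!: continuous_on_sum continuous_on_mult continuous_on_prod
        continuous_on_power continuous_on_component continuous_on_id continuous_on_const)
qed

section \<open>Interpolation of polynomials from values near 0\<close>

text \<open>The coefficients of the Lagrange basis polynomials invert the Vandermonde matrix:
  \<open>\<mu> a r\<close> is the coefficient of X^a in the basis polynomial of node
  \<open>r\<close>, and X^b is expanded in that basis.\<close>

lemma lagrange_coefficients:
  assumes "inj_on \<tau> {..N::nat}"
  obtains \<mu> :: "nat \<Rightarrow> nat \<Rightarrow> complex" where
    "\<And>a b. a \<le> N \<Longrightarrow> b \<le> N \<Longrightarrow> (\<Sum>r\<le>N. \<mu> a r * \<tau> r ^ b) = (if a = b then 1 else 0)"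
proof -
  define l where "l r = (\<Prod>j\<in>{..N} - {r}. smult (1 / (\<tau> r - \<tau> j)) [:- \<tau> j, 1:])" for r
  have deg: "degree (l r) \<le> N" if "r \<le> N" for r
  proof -
    have "degree (l r) \<le> (\<Sum>j\<in>{..N} - {r}. degree (smult (1 / (\<tau> r - \<tau> j)) [:- \<tau> j, 1:]))"
      unfolding l_def using degree_prod_sum_le by (metis (no_types, lifting) comp_apply finite_Diff finite_atMost sum.cong)
    also have "\<dots> \<le> (\<Sum>j\<in>{..N} - {r}. 1)" by (intro sum_mono) (auto simp: degree_smult_eq)
    also have "\<dots> = N" using that by simp
    finally show ?thesis .
  qed
  have val: "poly (l r) (\<tau> s) = (if r = s then 1 else 0)" if "r \<le> N" "s \<le> N" for r s
  proof (cases "r = s")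
    case True
    then show ?thesis 
      using assms that unfolding l_def poly_prod if_P[OF True]
      by (intro prod.neutral) (auto simp: inj_on_eq_iff simp flip: diff_divide_distrib)
  next
    case False
    then show ?thesis unfolding l_def poly_prod using that by (auto intro!: prod_zero)
  qed
  have eq: "(\<Sum>r\<le>N. smult (\<tau> r ^ b) (l r)) = monom 1 b" if b: "b \<le> N" for b
  proof (rule ccontr)
    let ?p = "(\<Sum>r\<le>N. smult (\<tau> r ^ b) (l r)) - monom 1 b"
    assume "\<not> ?thesis"
    then have nz: "?p \<noteq> 0" by simp
    have "degree ?p \<le> N"
      using deg b by (intro degree_diff_le degree_sum_le order.trans[OF degree_smult_le])
        (auto simp: degree_monom_eq)
    moreover have "\<tau> ` {..N} \<subseteq> {x. poly ?p x = 0}"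
      by (auto simp: poly_sum val poly_monom if_distrib[of "\<lambda>x. _ * x"] cong: if_cong)
    then have "card (\<tau> ` {..N}) \<le> card {x. poly ?p x = 0}"
      using poly_roots_finite[OF nz] card_mono by blast
    then have "N + 1 \<le> degree ?p"
      using card_poly_roots_bound[OF nz] assms by (simp add: card_image)
    ultimately show False by simp
  qed
  show ?thesis
  proof (rule that[of "\<lambda>a r. coeff (l r) a"])
    fix a b assume ab: "a \<le> N" "b \<le> N"
    have "coeff (\<Sum>r\<le>N. smult (\<tau> r ^ b) (l r)) a = (\<Sum>r\<le>N. coeff (l r) a * \<tau> r ^ b)"
      by (simp add: coeff_sum mult.commute)
    then show "(\<Sum>r\<le>N. coeff (l r) a * \<tau> r ^ b) = (if a = b then 1 else 0)"
      using eq[OF ab(2)] by auto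
  qed
qed

text \<open>Tensor product of one-variable interpolation: the nodes form a grid, and sums over it
  factor coordinate by coordinate. Each coefficient of a polynomial of degree at most
  \<open>N\<close> is thus a fixed linear combination of values near 0.\<close>

lemma multi_interpolation:
  fixes \<epsilon> :: real
  assumes "\<epsilon> > 0"
  obtains R :: "('n::finite \<Rightarrow> nat) set" and pt :: "('n \<Rightarrow> nat) \<Rightarrow> complex ^ 'n"
    and \<Lambda> :: "('n \<Rightarrow> nat) \<Rightarrow> ('n \<Rightarrow> nat) \<Rightarrow> complex"
  where "finite R" "\<And>\<rho>. \<rho> \<in> R \<Longrightarrow> norm (pt \<rho>) < \<epsilon>"
    "\<And>k l. k \<in> multi_indices_le N \<Longrightarrow> l \<in> multi_indices_le N \<Longrightarrow>
       (\<Sum>\<rho>\<in>R. \<Lambda> k \<rho> * vmonom l (pt \<rho>)) = (if k = l then 1 else 0)"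
proof -
  \<comment> \<open>Node coordinates are at most \<open>\<delta> * N\<close>, so their sum is at
    most \<open>\<epsilon> / 2\<close>.\<close>
  define \<delta> where "\<delta> = \<epsilon> / (2 * real CARD('n) * (real N + 1))"
  have \<delta>: "\<delta> > 0" using assms by (simp add: \<delta>_def)
  define \<tau> :: "nat \<Rightarrow> complex" where "\<tau> r = of_real (\<delta> * real r)" for r
  have "inj_on \<tau> {..N}" using \<delta> by (auto simp: \<tau>_def inj_on_def)
  then obtain \<mu> where \<mu>: "\<And>a b. a \<le> N \<Longrightarrow> b \<le> N \<Longrightarrow>
      (\<Sum>r\<le>N. \<mu> a r * \<tau> r ^ b) = (if a = b then 1 else 0)"
    by (rule lagrange_coefficients[of \<tau> N]) auto
  define R where "R = (UNIV :: 'n set) \<rightarrow>\<^sub>E {..N}"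
  define pt :: "('n \<Rightarrow> nat) \<Rightarrow> complex ^ 'n" where "pt \<rho> = (\<chi> i. \<tau> (\<rho> i))" for \<rho>
  define \<Lambda> where "\<Lambda> k \<rho> = (\<Prod>i\<in>UNIV. \<mu> (k i) (\<rho> i))" for k \<rho> :: "'n \<Rightarrow> nat"
  show ?thesis
  proof (rule that[of R pt \<Lambda>])
    show "finite R" unfolding R_def by (rule finite_PiE) auto
    show "norm (pt \<rho>) < \<epsilon>" if "\<rho> \<in> R" for \<rho>
    proof -
      have "norm (pt \<rho>) \<le> (\<Sum>i\<in>UNIV. norm (pt \<rho> $ i))" by (simp add: norm_vec_def L2_set_le_sum)
      also have "\<dots> \<le> (\<Sum>i\<in>(UNIV::'n set). \<delta> * (real N + 1))"
      proof (rule sum_mono)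
        fix i :: 'n
        have "\<rho> i \<le> N" using that by (auto simp: R_def PiE_iff)
        then show "norm (pt \<rho> $ i) \<le> \<delta> * (real N + 1)"
          using \<delta> by (simp add: pt_def \<tau>_def norm_mult)
      qed
      also have "\<dots> = \<epsilon> / 2"
      proof -
        have "real N + 1 \<noteq> 0" by linarith
        then have "\<delta> * (2 * real CARD('n) * (real N + 1)) = \<epsilon>" by (simp add: \<delta>_def)
        then show ?thesis by (simp add: mult_ac)
      qed
      finally show ?thesis using assms by linarith
    qed
    fix k l :: "'n \<Rightarrow> nat" assume kl: "k \<in> multi_indices_le N" "l \<in> multi_indices_le N"
    have le: "k i \<le> N" "l i \<le> N" for i
      using member_le_sum[of i UNIV k] member_le_sum[of i UNIV l] kl
      by (auto simp: multi_indices_le_def)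
    have "(\<Sum>\<rho>\<in>R. \<Lambda> k \<rho> * vmonom l (pt \<rho>)) =
        (\<Sum>\<rho>\<in>R. \<Prod>i\<in>UNIV. \<mu> (k i) (\<rho> i) * \<tau> (\<rho> i) ^ l i)"
      by (simp add: \<Lambda>_def vmonom_def pt_def prod.distrib)
    also have "\<dots> = (\<Prod>i\<in>UNIV. \<Sum>r\<le>N. \<mu> (k i) r * \<tau> r ^ l i)"
      unfolding R_def by (subst prod_sum_PiE) auto
    also have "\<dots> = (\<Prod>i\<in>UNIV. if k i = l i then 1 else 0)" using \<mu> le by simp
    also have "\<dots> = (if k = l then 1 else 0)" by (auto simp: fun_eq_iff)
    finally show "(\<Sum>\<rho>\<in>R. \<Lambda> k \<rho> * vmonom l (pt \<rho>)) = (if k = l then 1 else 0)" .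
  qed
qed

text \<open>The weights \<open>l\<close> do not depend on the forms, so each homogeneous part
  inherits regularity in a parameter from the sum of all parts at finitely many points.\<close>

lemma hform_interpolation:
  fixes \<epsilon> :: real
  assumes "\<epsilon> > 0"
  obtains R :: "('n::finite \<Rightarrow> nat) set" and pt :: "('n \<Rightarrow> nat) \<Rightarrow> complex ^ 'n"
    and l :: "('n \<Rightarrow> nat) \<Rightarrow> nat \<Rightarrow> complex ^ 'n \<Rightarrow> complex"
  where "finite R" "\<And>\<rho>. \<rho> \<in> R \<Longrightarrow> norm (pt \<rho>) < \<epsilon>" "\<And>\<rho> m. hform m (l \<rho> m)"
    "\<And>Q m v. (\<And>j. hform j (Q j)) \<Longrightarrow> m \<le> N \<Longrightarrow>
       Q m v = (\<Sum>\<rho>\<in>R. (\<Sum>j\<le>N. Q j (pt \<rho>)) * l \<rho> m v)"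
proof -
  obtain R :: "('n::finite \<Rightarrow> nat) set" and pt :: "('n \<Rightarrow> nat) \<Rightarrow> complex ^ 'n" and \<Lambda>
    where R: "finite R" "\<And>\<rho>. \<rho> \<in> R \<Longrightarrow> norm (pt \<rho>) < \<epsilon>"
    and \<Lambda>: "\<And>k l. k \<in> multi_indices_le N \<Longrightarrow> l \<in> multi_indices_le N \<Longrightarrow>
       (\<Sum>\<rho>\<in>R. \<Lambda> k \<rho> * vmonom l (pt \<rho>)) = (if k = l then 1 else 0)"
    by (rule multi_interpolation[OF assms, where N = N and 'n = 'n]) blast
  define l where "l \<rho> m v = (\<Sum>k\<in>exponents m. \<Lambda> k \<rho> * vmonom k v)" for \<rho> m v
  show ?thesis
  proof (rule that[OF R(1), of pt l])
    show "norm (pt \<rho>) < \<epsilon>" if "\<rho> \<in> R" for \<rho> using R(2)[OF that] .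
    show "hform m (l \<rho> m)" for \<rho> m unfolding hform_def l_def by (rule exI[of _ "\<lambda>k. \<Lambda> k \<rho>"]) simp
    fix Q m v assume Q: "\<And>j. hform j (Q j :: complex ^ 'n \<Rightarrow> complex)" and m: "m \<le> N"
    obtain c where c: "\<And>j x. Q j x = (\<Sum>k\<in>exponents j. c j k * vmonom k x)"
      using Q unfolding hform_def by metis
    define C where "C k = c (sum k UNIV) k" for k
    have Qs: "(\<Sum>j\<le>N. Q j x) = (\<Sum>k\<in>multi_indices_le N. C k * vmonom k x)" for x
      unfolding sum_multi_indices_le c by (intro sum.cong) (auto simp: C_def exponents_def)
    have Ck: "C k = (\<Sum>\<rho>\<in>R. (\<Sum>j\<le>N. Q j (pt \<rho>)) * \<Lambda> k \<rho>)" if "k \<in> multi_indices_le N" for k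
    proof -
      have "(\<Sum>\<rho>\<in>R. (\<Sum>j\<le>N. Q j (pt \<rho>)) * \<Lambda> k \<rho>) =
          (\<Sum>\<rho>\<in>R. \<Sum>l\<in>multi_indices_le N. C l * (\<Lambda> k \<rho> * vmonom l (pt \<rho>)))"
        unfolding Qs sum_distrib_right by (simp add: mult_ac)
      also have "\<dots> = (\<Sum>l\<in>multi_indices_le N. C l * (\<Sum>\<rho>\<in>R. \<Lambda> k \<rho> * vmonom l (pt \<rho>)))"
        by (subst sum.swap) (simp add: sum_distrib_left)
      also have "\<dots> = (\<Sum>l\<in>multi_indices_le N. C l * (if k = l then 1 else 0))"
        using that by (intro sum.cong refl arg_cong2[of _ _ _ _ "(*)"] \<Lambda>) auto
      also have "\<dots> = C k"
        using that
        by (simp add: finite_multi_indices_le if_distrib[of "\<lambda>x. _ * x"] sum.delta cong: if_cong)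
      finally show ?thesis by simp
    qed
    have "Q m v = (\<Sum>k\<in>exponents m. C k * vmonom k v)"
      unfolding c by (intro sum.cong) (auto simp: C_def exponents_def)
    also have "\<dots> = (\<Sum>k\<in>exponents m. (\<Sum>\<rho>\<in>R. (\<Sum>j\<le>N. Q j (pt \<rho>)) * \<Lambda> k \<rho>) * vmonom k v)"
      using m by (intro sum.cong refl, subst Ck) (auto simp: exponents_def multi_indices_le_def)
    also have "\<dots> = (\<Sum>\<rho>\<in>R. (\<Sum>j\<le>N. Q j (pt \<rho>)) * l \<rho> m v)"
      unfolding l_def sum_distrib_right sum_distrib_left
      by (subst sum.swap) (simp add: mult.assoc)
    finally show "Q m v = (\<Sum>\<rho>\<in>R. (\<Sum>j\<le>N. Q j (pt \<rho>)) * l \<rho> m v)" .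
  qed
qed

text \<open>The coefficient at \<open>k\<close> is a linear combination of values of the form at
  grid points, all of which are zero.\<close>

lemma hform_eq_0D:
  fixes c :: "('n::finite \<Rightarrow> nat) \<Rightarrow> complex"
  assumes "\<And>x. (\<Sum>k\<in>exponents m. c k * vmonom k x) = 0" and "k \<in> exponents m"
  shows "c k = 0"
proof -
  obtain R :: "('n::finite \<Rightarrow> nat) set" and pt :: "('n \<Rightarrow> nat) \<Rightarrow> complex ^ 'n" and \<Lambda>
    where R: "finite R"
    and \<Lambda>: "\<And>k l. k \<in> multi_indices_le m \<Longrightarrow> l \<in> multi_indices_le m \<Longrightarrow>
       (\<Sum>\<rho>\<in>R. \<Lambda> k \<rho> * vmonom l (pt \<rho>)) = (if k = l then 1 else 0)"
    by (rule multi_interpolation[OF zero_less_one, where N = m and 'n = 'n]) blast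
  have sub: "exponents m \<subseteq> multi_indices_le m" by (auto simp: exponents_def multi_indices_le_def)
  have "0 = (\<Sum>\<rho>\<in>R. \<Lambda> k \<rho> * (\<Sum>l\<in>exponents m. c l * vmonom l (pt \<rho>)))"
    using assms(1) by simp
  also have "\<dots> = (\<Sum>l\<in>exponents m. c l * (\<Sum>\<rho>\<in>R. \<Lambda> k \<rho> * vmonom l (pt \<rho>)))"
    unfolding sum_distrib_left by (subst sum.swap) (simp add: algebra_simps)
  also have "\<dots> = (\<Sum>l\<in>exponents m. c l * (if k = l then 1 else 0))"
    using assms(2) sub by (intro sum.cong refl arg_cong2[of _ _ _ _ "(*)"] \<Lambda>) auto
  also have "\<dots> = c k"
    using assms(2)
    by (simp add: finite_exponents if_distrib[of "\<lambda>x. _ * x"] sum.delta' cong: if_cong)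
  finally show ?thesis by simp
qed

section \<open>Intersection points of lines with a hypersurface\<close>

text \<open>Identifies a pair in C^(n-1) x C with a point of C^n. The line with parameters
  \<open>\<alpha>\<close>, \<open>\<beta>\<close> is traced by
  \<open>t \<mapsto> vjoin (t *s \<alpha> + \<beta>) t\<close>.\<close>

definition vjoin :: "complex ^ 'm::finite \<Rightarrow> complex \<Rightarrow> complex ^ 'm option"
  where "vjoin a x = (\<chi> i. case i of None \<Rightarrow> x | Some k \<Rightarrow> a $ k)"

lemma vjoin_nth [simp]: "vjoin a x $ None = x" "vjoin a x $ Some k = a $ k"
  by (simp_all add: vjoin_def)

lemma vec_option_eqI: "u $ None = v $ None \<Longrightarrow> (\<And>k. u $ Some k = v $ Some k) \<Longrightarrow> u = v"
  by (simp add: vec_eq_iff split_option_all)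

lemma norm_vjoin_0 [simp]: "norm (vjoin a 0) = norm a"
  by (simp add: norm_vec_def L2_set_def UNIV_option_conv sum.reindex)

lemma norm_smult_vec: "norm (c *s v) = cmod c * norm (v :: complex ^ 'n::finite)"
  by (simp add: norm_vec_def norm_mult L2_set_right_distrib)

lemma bounded_linear_vjoin_0: "bounded_linear (\<lambda>a. vjoin a 0)"
  by (rule bounded_linear_intro[of _ 1]) (auto intro!: vec_option_eqI)

lemma norm_vjoin_le: "norm (vjoin a x) \<le> norm a + cmod x"
proof -
  have "vjoin a x = vjoin a 0 + vjoin 0 x" by (auto intro!: vec_option_eqI)
  then have "norm (vjoin a x) \<le> norm (vjoin a 0) + norm (vjoin (0 :: complex ^ 'a) x)"
    by (metis norm_triangle_ineq)
  moreover have "norm (vjoin (0 :: complex ^ 'a) x) = cmod x"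
    by (simp add: norm_vec_def L2_set_def UNIV_option_conv sum.reindex)
  ultimately show ?thesis by simp
qed

lemma bounded_bilinear_smult_vec: "bounded_bilinear (\<lambda>c (v :: complex ^ 'n::finite). c *s v)"
  by (rule bounded_bilinear.intro)
    (auto simp: vec_eq_iff algebra_simps norm_smult_vec intro!: exI[of _ 1])

lemma mem_affine_line_iff: "\<zeta> \<in> affine_line \<alpha> \<beta> \<longleftrightarrow> \<zeta> = vjoin (\<zeta> $ None *s \<alpha> + \<beta>) (\<zeta> $ None)"
  by (auto simp: affine_line_def vec_eq_iff split_option_all mult.commute)

text \<open>Along a curve in \<open>S\<close> with velocity \<open>v\<close> the function
  \<open>f\<close> is constant near time 0, and the chain rule identifies its derivative there with
  \<open>f' v\<close>.\<close>

lemma tangent_space_level_set: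
  assumes v: "v \<in> tangent_space S p" and f: "(f has_derivative f') (at p)"
    and V: "open V" "p \<in> V" and const: "\<And>x. x \<in> S \<inter> V \<Longrightarrow> f x = k"
  shows "f' v = 0"
proof -
  obtain c where c: "c 0 = p" "\<forall>\<^sub>F t in nhds 0. c t \<in> S"
    "(c has_vector_derivative v) (at (0::real))"
    using v by (auto simp: tangent_space_def)
  have cd: "(c has_derivative (\<lambda>t. t *\<^sub>R v)) (at 0)"
    using c(3) by (simp add: has_vector_derivative_def)
  have "isCont c 0" using cd by (rule has_derivative_continuous)
  then have "\<forall>\<^sub>F t in at 0. c t \<in> V"
    using V c(1) by (auto simp: isCont_def dest!: topological_tendstoD)
  moreover have "\<forall>\<^sub>F t in at 0. c t \<in> S"
    using c(2) by (simp add: eventually_at_filter eventually_mono)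
  ultimately have ev: "\<forall>\<^sub>F t in at 0. f (c t) = k"
    by eventually_elim (use const in auto)
  have p: "f (c 0) = k"
    using c const V eventually_nhds_x_imp_x[OF c(2)] by auto
  have "((\<lambda>t. f (c t)) has_derivative (\<lambda>t. f' (t *\<^sub>R v))) (at 0)"
    using has_derivative_compose[OF cd, of f f'] f c(1) by simp
  then have "((\<lambda>t. k) has_derivative (\<lambda>t. f' (t *\<^sub>R v))) (at (0::real))"
    using has_derivative_transform_eventually[OF _ ev] p by simp
  then have "(\<lambda>t::real. f' (t *\<^sub>R v)) = (\<lambda>t. 0)"
    using has_derivative_unique[OF _ has_derivative_const] by blast
  from fun_cong[OF this, of 1] show ?thesis by simp
qed

text \<open>If \<open>f'\<close> killed the direction \<open>vjoin \<alpha> 1\<close> of the line,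
  it would kill the tangent spaces of both the line and \<open>S\<close>, hence everything by
  transversality, contrary to the choice of the local equation. The nonvanishing is the condition of
  the implicit function theorem.\<close>

lemma transversal_local_equation:
  fixes \<alpha> \<beta> :: "complex ^ 'm::finite"
  assumes S: "smooth_hypersurface S" and tr: "transversal_at (affine_line \<alpha> \<beta>) S q"
  obtains V f f' where "open V" "q \<in> V" "continuous_on V f" "S \<inter> V = {z \<in> V. f z = 0}"
    "(f has_derivative f') (at q)" "\<And>c v. f' (c *s v) = c * f' v" "f' (vjoin \<alpha> 1) \<noteq> 0"
proof -
  have q: "q \<in> S" using tr by (auto simp: transversal_at_def)
  then obtain V f where V: "open V" "q \<in> V" and hol: "mv_holomorphic_on f V"
    and nz: "frechet_derivative f (at q) \<noteq> (\<lambda>v. 0)" and eq: "S \<inter> V = {z \<in> V. f z = 0}"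
    using S unfolding smooth_hypersurface_def by blast
  obtain f' where f': "(f has_derivative f') (at q)" "\<And>c v. f' (c *s v) = c * f' v"
    using hol V by (auto simp: mv_holomorphic_on_def)
  have lin: "linear f'" using f'(1) by (rule has_derivative_linear)
  have "continuous_on V f"
    using hol by (auto simp: mv_holomorphic_on_def intro!: continuous_at_imp_continuous_on
        dest: has_derivative_continuous)
  moreover have "f' (vjoin \<alpha> 1) \<noteq> 0"
  proof
    assume 0: "f' (vjoin \<alpha> 1) = 0"
    have "f' w = 0" for w
    proof -
      obtain u v where uv: "w = u + v" "u \<in> tangent_space (affine_line \<alpha> \<beta>) q" "v \<in> tangent_space S q"
        using tr UNIV_I[of w] unfolding transversal_at_def by blast
      have "u $ Some k = \<alpha> $ k * u $ None" for k
      proof -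
        have "bounded_linear (\<lambda>\<zeta> :: complex ^ 'm option. \<zeta> $ Some k - \<alpha> $ k * \<zeta> $ None)"
          by (intro bounded_linear_sub bounded_linear_vec_nth bounded_linear_mult_right
              bounded_linear_compose[OF bounded_linear_mult_right])
        from tangent_space_level_set[OF uv(2) bounded_linear_imp_has_derivative[OF this] open_UNIV,
            where k = "\<beta> $ k"]
        show ?thesis by (auto simp: affine_line_def)
      qed
      then have "u = u $ None *s vjoin \<alpha> 1" by (intro vec_option_eqI) (auto simp: mult.commute)
      then have "f' u = 0" using f'(2) 0 by (metis mult_zero_right)
      moreover have "f' v = 0"
        using tangent_space_level_set[OF uv(3) f'(1) V, of 0] eq by auto
      ultimately show ?thesis using uv(1) lin by (simp add: linear_add)
    qed
    then show False using nz frechet_derivative_at[OF f'(1)] by auto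
  qed
  ultimately show thesis using that V eq f' by blast
qed

text \<open>An implicit function theorem: a fixed point argument produces a zero of the local
  equation close to the base point, the assumed uniqueness of the intersection identifies it, and
  the first-order expansion there gives the derivative. Changing the parameters by
  \<open>(a, b)\<close> moves the point of the line with last coordinate \<open>z\<close> by
  \<open>z *s a + b\<close>, which explains the argument of \<open>L\<close>.\<close>

lemma intersection_point_derivative:
  fixes \<alpha> \<beta> :: "complex ^ 'm::finite" and p :: "complex ^ 'm \<Rightarrow> complex ^ 'm \<Rightarrow> complex ^ 'm option"
  assumes S: "smooth_hypersurface S" and tr: "transversal_at (affine_line \<alpha> \<beta>) S (p \<alpha> \<beta>)"
    and ev: "\<forall>\<^sub>F (a, b) in nhds (\<alpha>, \<beta>). affine_line a b \<inter> S = {p a b}"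
  obtains L where "bounded_linear L" "\<And>c v. L (c *s v) = c * L v"
    "((\<lambda>(a, b). p a b $ None) has_derivative (\<lambda>(a, b). L (p \<alpha> \<beta> $ None *s a + b))) (at (\<alpha>, \<beta>))"
proof -
  define q where "q = p \<alpha> \<beta>"
  define z0 where "z0 = q $ None"
  define pt where "pt a b z = vjoin (z *s a + b) z" for a b :: "complex ^ 'm" and z
  obtain V f f' where V: "open V" "q \<in> V" and cont: "continuous_on V f"
    and eq: "S \<inter> V = {z \<in> V. f z = 0}" and f': "(f has_derivative f') (at q)"
    "\<And>c v. f' (c *s v) = c * f' v" and nz: "f' (vjoin \<alpha> 1) \<noteq> 0"
    by (rule transversal_local_equation[OF S tr]) (auto simp: q_def)
  define B where "B = f' (vjoin \<alpha> 1)"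
  have B: "B \<noteq> 0" "cmod B > 0" using nz by (auto simp: B_def)
  have bl: "bounded_linear f'" using f'(1) by (rule has_derivative_bounded_linear)
  note lin = bounded_linear.linear[OF bl]
  have qS: "q \<in> S" and ql: "q \<in> affine_line \<alpha> \<beta>" using tr by (auto simp: transversal_at_def q_def)
  have q: "q = pt \<alpha> \<beta> z0" using ql by (simp add: mem_affine_line_iff pt_def z0_def)
  have fq: "f q = 0" using eq qS V by blast
  obtain K where K: "K > 0" "\<And>u. cmod (f' u) \<le> K * norm u"
    using bounded_linear.pos_bounded[OF bl] by (metis mult.commute)
  have key: "\<exists>\<rho>>0. \<forall>\<zeta>. norm (\<zeta> - q) < \<rho> \<longrightarrow> \<zeta> \<in> V \<and> cmod (f \<zeta> - f' (\<zeta> - q)) \<le> e * norm (\<zeta> - q)"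
    if "e > 0" for e
  proof -
    obtain r1 where "r1 > 0" "ball q r1 \<subseteq> V" using V open_contains_ball by blast
    moreover obtain r2 where "r2 > 0" "\<forall>\<zeta>. norm (\<zeta> - q) < r2 \<longrightarrow>
        cmod (f \<zeta> - f q - f' (\<zeta> - q)) \<le> e * norm (\<zeta> - q)"
      using f'(1)[unfolded has_derivative_at_alt, THEN conjunct2, rule_format, OF \<open>e > 0\<close>] by blast
    ultimately show ?thesis
      by (intro exI[of _ "min r1 r2"]) (auto simp: fq dist_norm norm_minus_commute subset_iff)
  qed
  \<comment> \<open>The displacement from \<open>q\<close> splits into a part along the line, where
    \<open>f'\<close> acts through \<open>B\<close>, and a part in the other coordinates that is
    O(\<eta>) for bounded \<open>z\<close>.\<close>
  have pt_diff: "pt a b z - q = (z - z0) *s vjoin \<alpha> 1 + vjoin (z *s (a - \<alpha>) + (b - \<beta>)) 0" for a b z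
    unfolding q pt_def by (intro vec_option_eqI) (simp_all add: algebra_simps)
  have f'_diff: "f' (pt a b z - q) = (z - z0) * B + f' (vjoin (z *s (a - \<alpha>) + (b - \<beta>)) 0)" for a b z
    unfolding pt_diff linear_add[OF lin] f'(2) B_def ..
  define C1 where "C1 = norm (vjoin \<alpha> 1) + 1"
  define C2 where "C2 = cmod z0 + 2"
  define \<eta> where "\<eta> a b = norm ((a, b) - (\<alpha>, \<beta>))" for a b
  have C: "C1 > 0" "C2 > 0" unfolding C1_def C2_def by (simp_all add: add_nonneg_pos)
  have \<eta>0: "\<eta> a b \<ge> 0" for a b by (simp add: \<eta>_def)
  have le_\<eta>: "norm (a - \<alpha>) \<le> \<eta> a b" "norm (b - \<beta>) \<le> \<eta> a b" for a b
    using norm_fst_le[of "a - \<alpha>" "b - \<beta>"] norm_snd_le[of "b - \<beta>" "a - \<alpha>"]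
    by (simp_all add: \<eta>_def)
  have small: "norm (z *s (a - \<alpha>) + (b - \<beta>)) \<le> C2 * \<eta> a b" if "cmod (z - z0) \<le> 1" for a b z
  proof -
    have "cmod z \<le> cmod z0 + 1" using norm_triangle_sub[of z z0] that by linarith
    then have "norm (z *s (a - \<alpha>)) \<le> (cmod z0 + 1) * \<eta> a b"
      unfolding norm_smult_vec by (intro mult_mono le_\<eta>) auto
    then show ?thesis using le_\<eta>(2)[of b a] norm_triangle_ineq[of "z *s (a - \<alpha>)" "b - \<beta>"]
      unfolding C2_def by (simp add: algebra_simps)
  qed
  have pt_le: "norm (pt a b z - q) \<le> C1 * cmod (z - z0) + C2 * \<eta> a b" if "cmod (z - z0) \<le> 1" for a b z
  proof -
    have "norm (pt a b z - q) \<le> norm ((z - z0) *s vjoin \<alpha> 1) + norm (vjoin (z *s (a - \<alpha>) + (b - \<beta>)) 0)"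
      unfolding pt_diff by (rule norm_triangle_ineq)
    also have "\<dots> \<le> cmod (z - z0) * C1 + C2 * \<eta> a b"
      unfolding norm_smult_vec norm_vjoin_0
      by (intro add_mono mult_left_mono small that) (auto simp: C1_def)
    finally show ?thesis by (simp add: mult.commute)
  qed
  obtain \<eta>1 where \<eta>1: "\<eta>1 > 0" "\<And>a b. \<eta> a b < \<eta>1 \<Longrightarrow> affine_line a b \<inter> S = {p a b}"
    using ev by (auto simp: eventually_nhds_metric dist_norm \<eta>_def)

  text \<open>Brouwer's theorem for \<open>z \<mapsto> z - f (pt a b z) / B\<close> on a disc of radius \<open>O(\<eta>)\<close> produces
    a point of \<open>S\<close> on the line, which must be \<open>p a b\<close>.\<close>
  define e where "e = cmod B / (4 * C1)"
  have e: "e > 0" using B C by (simp add: e_def)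
  obtain \<rho> where \<rho>: "\<rho> > 0" "\<And>\<zeta>. norm (\<zeta> - q) < \<rho> \<Longrightarrow> \<zeta> \<in> V"
    "\<And>\<zeta>. norm (\<zeta> - q) < \<rho> \<Longrightarrow> cmod (f \<zeta> - f' (\<zeta> - q)) \<le> e * norm (\<zeta> - q)"
    using key[OF e] by blast
  \<comment> \<open>With this value the terms containing \<open>C2\<close> contribute
    \<open>cmod B / 2\<close> times the radius \<open>C * \<eta> a b\<close>; since
    \<open>e * C1 = cmod B / 4\<close>, the disc is mapped into itself.\<close>
  define C where "C = 2 * (e + K) * C2 / cmod B"
  have C0: "C > 0" using e K C B by (simp add: C_def)
  \<comment> \<open>Below \<open>\<eta>2\<close> the intersection is the single point
    \<open>p a b\<close>, the radius is at most 1, and \<open>pt a b\<close> sends the disc into the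
    \<open>\<rho>\<close>-ball around \<open>q\<close>.\<close>
  define \<eta>2 where "\<eta>2 = min \<eta>1 (min (1 / C) (\<rho> / (C1 * C + C2)))"
  have \<eta>2: "\<eta>2 > 0" using \<eta>1 C0 C \<rho>(1) by (simp add: \<eta>2_def add_pos_pos)
  have lip: "cmod (p a b $ None - z0) \<le> C * \<eta> a b" if h: "\<eta> a b < \<eta>2" for a b
  proof -
    let ?r = "C * \<eta> a b"
    let ?T = "\<lambda>z. z - f (pt a b z) / B"
    have r: "?r \<ge> 0" "?r \<le> 1" using h C0 \<eta>0[of a b] by (auto simp: \<eta>2_def field_simps)
    have near: "norm (pt a b z - q) \<le> (C1 * C + C2) * \<eta> a b" "norm (pt a b z - q) < \<rho>"
      if "z \<in> cball z0 ?r" for z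
    proof -
      have z: "cmod (z - z0) \<le> ?r" using that by (simp add: dist_norm norm_minus_commute)
      have "norm (pt a b z - q) \<le> C1 * cmod (z - z0) + C2 * \<eta> a b" using z r by (intro pt_le) auto
      also have "\<dots> \<le> C1 * ?r + C2 * \<eta> a b" using z C by simp
      finally show 1: "norm (pt a b z - q) \<le> (C1 * C + C2) * \<eta> a b" by (simp add: algebra_simps)
      have "\<eta> a b < \<rho> / (C1 * C + C2)" using h by (simp add: \<eta>2_def)
      then have "(C1 * C + C2) * \<eta> a b < \<rho>" using C C0 by (simp add: field_simps add_pos_pos)
      with 1 show "norm (pt a b z - q) < \<rho>" by linarith
    qed
    have cont_pt: "continuous_on A (pt a b)" for A
    proof -
      have eq: "pt a b = (\<lambda>z. \<chi> i. case i of None \<Rightarrow> z | Some k \<Rightarrow> z * a $ k + b $ k)"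
        by (rule ext) (auto simp: pt_def vjoin_def vec_eq_iff split: option.split)
      have "continuous_on A (\<lambda>z. case i of None \<Rightarrow> z | Some k \<Rightarrow> z * a $ k + b $ k)" for i
        by (cases i) (simp_all add: continuous_on_id continuous_on_add continuous_on_mult continuous_on_const)
      then show ?thesis unfolding eq by (intro continuous_on_vec_lambda)
    qed
    have "continuous_on (cball z0 ?r) ?T"
      using near \<rho>(2) B by (intro continuous_intros continuous_on_compose2[OF cont cont_pt]) auto
    moreover have "?T ` cball z0 ?r \<subseteq> cball z0 ?r"
    proof clarify
      fix z assume z: "z \<in> cball z0 ?r"
      have "f (pt a b z) - (z - z0) * B =
          (f (pt a b z) - f' (pt a b z - q)) + f' (vjoin (z *s (a - \<alpha>) + (b - \<beta>)) 0)"
        unfolding f'_diff by simp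
      then have "cmod (f (pt a b z) - (z - z0) * B) \<le>
          cmod (f (pt a b z) - f' (pt a b z - q)) + cmod (f' (vjoin (z *s (a - \<alpha>) + (b - \<beta>)) 0))"
        by (metis norm_triangle_ineq)
      also have "\<dots> \<le> e * ((C1 * C + C2) * \<eta> a b) + K * (C2 * \<eta> a b)"
      proof (rule add_mono)
        show "cmod (f (pt a b z) - f' (pt a b z - q)) \<le> e * ((C1 * C + C2) * \<eta> a b)"
          using \<rho>(3)[OF near(2)[OF z]] near(1)[OF z] e by (meson order.trans mult_left_mono less_imp_le)
        have "cmod (z - z0) \<le> 1" using z r by (simp add: dist_norm norm_minus_commute)
        then show "cmod (f' (vjoin (z *s (a - \<alpha>) + (b - \<beta>)) 0)) \<le> K * (C2 * \<eta> a b)"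
          using K(2)[of "vjoin (z *s (a - \<alpha>) + (b - \<beta>)) 0"] small[of z a b] K(1)
          by (simp del: vjoin_nth) (meson order.trans mult_left_mono less_imp_le)
      qed
      also have "\<dots> = (e * C1) * ?r + (e + K) * C2 * \<eta> a b" by (simp add: algebra_simps)
      also have "e * C1 = cmod B / 4" using C by (simp add: e_def)
      also have "(e + K) * C2 * \<eta> a b = cmod B * ?r / 2" using B by (simp add: C_def)
      finally have "cmod (f (pt a b z) - (z - z0) * B) \<le> cmod B * ?r"
        using mult_nonneg_nonneg[OF norm_ge_zero[of B] r(1)] by (simp only: times_divide_eq_left)
      moreover have "?T z - z0 = - ((f (pt a b z) - (z - z0) * B) / B)"
        using B by (simp add: field_simps)
      ultimately have "cmod (?T z - z0) \<le> ?r"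
        using B by (simp add: norm_divide divide_le_eq mult.commute del: minus_divide_left)
      then show "?T z \<in> cball z0 ?r" by (simp add: dist_norm norm_minus_commute)
    qed
    ultimately obtain z where z: "z \<in> cball z0 ?r" "?T z = z"
      using brouwer[of "cball z0 ?r" ?T] r by (auto simp: Pi_iff image_subset_iff)
    then have "f (pt a b z) = 0" using B by simp
    then have "pt a b z \<in> S" using near(2)[OF z(1)] \<rho>(2) eq by blast
    moreover have "pt a b z \<in> affine_line a b" by (simp add: mem_affine_line_iff pt_def)
    moreover have "\<eta> a b < \<eta>1" using h by (simp add: \<eta>2_def)
    ultimately have "pt a b z \<in> {p a b}" using \<eta>1(2)[of a b] by (metis IntI)
    then have "p a b = pt a b z" by simp
    then show ?thesis using z(1) by (simp add: pt_def dist_norm norm_minus_commute)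
  qed

  \<comment> \<open>Solving \<open>(z - z0) * B + f' (vjoin v 0) = 0\<close> for
    \<open>z - z0\<close> yields \<open>L v\<close>.\<close>
  define L where "L v = - f' (vjoin v 0) / B" for v
  have L_bl: "bounded_linear L"
    unfolding L_def by (intro bounded_linear_divide bounded_linear_compose[OF bounded_linear_divide]
        bounded_linear_minus bounded_linear_compose[OF bl bounded_linear_vjoin_0])
  have L_smult: "L (c *s v) = c * L v" for c v
  proof -
    have "vjoin (c *s v) 0 = c *s vjoin v 0" by (intro vec_option_eqI) auto
    then show ?thesis by (simp add: L_def f'(2))
  qed
  have L_le: "cmod (L v) \<le> K / cmod B * norm v" for v
    using K(2)[of "vjoin v 0"] B by (simp add: L_def norm_divide field_simps)
  have z0': "p \<alpha> \<beta> $ None = z0" by (simp add: z0_def q_def)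
  show thesis
  proof (rule that[OF L_bl L_smult])
    show "((\<lambda>(a, b). p a b $ None) has_derivative (\<lambda>(a, b). L (p \<alpha> \<beta> $ None *s a + b))) (at (\<alpha>, \<beta>))"
      unfolding has_derivative_at_alt z0'
    proof (intro conjI allI impI)
      show "bounded_linear (\<lambda>(a, b). L (z0 *s a + b))"
        unfolding case_prod_beta
        by (intro bounded_linear_compose[OF L_bl] bounded_linear_add bounded_linear_snd
            bounded_linear_compose[OF bounded_bilinear.bounded_linear_right[OF bounded_bilinear_smult_vec]]
            bounded_linear_fst)
      fix \<epsilon> :: real assume \<epsilon>: "\<epsilon> > 0"
      \<comment> \<open>One half of \<open>\<epsilon>\<close> is spent on the remainder of
        \<open>f\<close> at \<open>q\<close>. The other half pays for replacing \<open>z\<close> by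
        \<open>z0\<close> in the argument of \<open>L\<close>, an error quadratic in
        \<open>\<eta>\<close> that the last bound in \<open>\<delta>\<close> controls.\<close>
      define e' where "e' = (\<epsilon> * cmod B / 2) / (C1 * C + C2)"
      have CC: "C1 * C + C2 > 0" using C C0 by (simp add: add_pos_pos)
      have e': "e' > 0" using \<epsilon> B CC by (simp add: e'_def)
      obtain \<rho>' where \<rho>': "\<rho>' > 0"
        "\<And>\<zeta>. norm (\<zeta> - q) < \<rho>' \<Longrightarrow> \<zeta> \<in> V \<and> cmod (f \<zeta> - f' (\<zeta> - q)) \<le> e' * norm (\<zeta> - q)"
        using key[OF e'] by blast
      define \<delta> where "\<delta> = min \<eta>2 (min (\<rho>' / (C1 * C + C2)) (\<epsilon> * cmod B / (2 * K * C)))"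
      have \<delta>: "\<delta> > 0" using \<eta>2 \<rho>'(1) CC \<epsilon> B K C0 by (simp add: \<delta>_def)
      have main: "cmod (p a b $ None - z0 - L (z0 *s (a - \<alpha>) + (b - \<beta>))) \<le> \<epsilon> * \<eta> a b"
        if h: "\<eta> a b < \<delta>" for a b
      proof -
        define z where "z = p a b $ None"
        have h2: "\<eta> a b < \<eta>2" and h1: "\<eta> a b < \<eta>1" using h by (auto simp: \<delta>_def \<eta>2_def)
        have zle: "cmod (z - z0) \<le> C * \<eta> a b" using lip[OF h2] by (simp add: z_def)
        have "C * \<eta> a b \<le> 1" using h2 C0 by (auto simp: \<eta>2_def field_simps)
        then have z1: "cmod (z - z0) \<le> 1" using zle by linarith
        have pab: "p a b \<in> affine_line a b" "p a b \<in> S" using \<eta>1(2)[OF h1] by auto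
        have pz: "p a b = pt a b z" using pab(1) by (simp add: mem_affine_line_iff pt_def z_def)
        have "norm (pt a b z - q) \<le> C1 * cmod (z - z0) + C2 * \<eta> a b" by (rule pt_le[OF z1])
        also have "\<dots> \<le> C1 * (C * \<eta> a b) + C2 * \<eta> a b" using zle C by simp
        finally have d: "norm (pt a b z - q) \<le> (C1 * C + C2) * \<eta> a b" by (simp add: algebra_simps)
        have "\<eta> a b < \<rho>' / (C1 * C + C2)" using h by (simp add: \<delta>_def)
        then have "(C1 * C + C2) * \<eta> a b < \<rho>'" using CC by (simp add: field_simps)
        then have d': "norm (pt a b z - q) < \<rho>'" using d by linarith
        then have "f (pt a b z) = 0" using \<rho>'(2)[OF d'] pab(2) eq pz by auto
        then have "cmod (f' (pt a b z - q)) \<le> e' * norm (pt a b z - q)"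
          using \<rho>'(2)[OF d'] by simp
        also have "\<dots> \<le> e' * ((C1 * C + C2) * \<eta> a b)" using d e' by (intro mult_left_mono) auto
        also have "\<dots> = (e' * (C1 * C + C2)) * \<eta> a b" by (simp only: mult.assoc)
        also have "e' * (C1 * C + C2) = \<epsilon> * cmod B / 2"
          using CC unfolding e'_def by (metis nonzero_eq_divide_eq less_irrefl)
        also have "\<epsilon> * cmod B / 2 * \<eta> a b = cmod B * (\<epsilon> / 2 * \<eta> a b)" by simp
        finally have 1: "cmod (f' (pt a b z - q) / B) \<le> \<epsilon> / 2 * \<eta> a b"
          using B by (simp add: norm_divide divide_le_eq mult.commute)
        have "cmod (L ((z - z0) *s (a - \<alpha>))) \<le> K / cmod B * (cmod (z - z0) * norm (a - \<alpha>))"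
          using L_le[of "(z - z0) *s (a - \<alpha>)"] unfolding norm_smult_vec .
        also have "\<dots> \<le> K / cmod B * ((C * \<eta> a b) * \<eta> a b)"
          using zle le_\<eta> K B \<eta>0 C0 by (intro mult_left_mono mult_mono) auto
        also have "\<dots> = (K * C / cmod B * \<eta> a b) * \<eta> a b" by simp
        also have "\<dots> \<le> \<epsilon> / 2 * \<eta> a b"
        proof (rule mult_right_mono)
          have "\<eta> a b \<le> \<epsilon> * cmod B / (2 * K * C)" using h by (simp add: \<delta>_def)
          then show "K * C / cmod B * \<eta> a b \<le> \<epsilon> / 2" using K B C0 by (simp add: field_simps)
        qed (rule \<eta>0)
        finally have 2: "cmod (L ((z - z0) *s (a - \<alpha>))) \<le> \<epsilon> / 2 * \<eta> a b" .
        have "z *s (a - \<alpha>) + (b - \<beta>) = (z0 *s (a - \<alpha>) + (b - \<beta>)) + (z - z0) *s (a - \<alpha>)"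
          by (simp add: vec_eq_iff algebra_simps)
        then have "L (z *s (a - \<alpha>) + (b - \<beta>)) = L (z0 *s (a - \<alpha>) + (b - \<beta>)) + L ((z - z0) *s (a - \<alpha>))"
          by (simp only: linear_add[OF bounded_linear.linear[OF L_bl]])
        moreover have "f' (pt a b z - q) / B = (z - z0) - L (z *s (a - \<alpha>) + (b - \<beta>))"
          unfolding f'_diff L_def using B by (simp add: add_divide_distrib)
        ultimately have "z - z0 - L (z0 *s (a - \<alpha>) + (b - \<beta>)) =
            f' (pt a b z - q) / B + L ((z - z0) *s (a - \<alpha>))"
          by simp
        then show ?thesis
          using norm_triangle_ineq[of "f' (pt a b z - q) / B" "L ((z - z0) *s (a - \<alpha>))"] 1 2
          unfolding z_def by simp
      qed
      show "\<exists>\<delta>>0. \<forall>y. norm (y - (\<alpha>, \<beta>)) < \<delta> \<longrightarrow>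
          cmod ((case y of (a, b) \<Rightarrow> p a b $ None) - (case (\<alpha>, \<beta>) of (a, b) \<Rightarrow> p a b $ None) -
            (case y - (\<alpha>, \<beta>) of (a, b) \<Rightarrow> L (z0 *s a + b))) \<le> \<epsilon> * norm (y - (\<alpha>, \<beta>))"
        using \<delta> main by (intro exI[of _ \<delta>]) (auto simp: \<eta>_def z0')
    qed
  qed
qed

section \<open>Elementary symmetric functions of shock waves\<close>

text \<open>Read off from the generating polynomial with factors 1 + w_j X, so that adjoining an
  index multiplies by one linear factor.\<close>

definition esym :: "'i set \<Rightarrow> ('i \<Rightarrow> complex) \<Rightarrow> nat \<Rightarrow> complex"
  where "esym A w i = coeff (\<Prod>j\<in>A. [:1, w j:]) i"

lemma esym_0 [simp]: "esym A w 0 = 1"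
  by (induction A rule: infinite_finite_induct) (simp_all add: esym_def)

lemma esym_empty: "esym {} w (Suc i) = 0"
  by (simp add: esym_def)

lemma esym_insert:
  "finite A \<Longrightarrow> j \<notin> A \<Longrightarrow> esym (insert j A) w (Suc i) = esym A w (Suc i) + w j * esym A w i"
  by (simp add: esym_def)

lemma esym_1: "finite A \<Longrightarrow> esym A w (Suc 0) = (\<Sum>j\<in>A. w j)"
  by (induction A rule: finite_induct) (simp_all add: esym_empty esym_insert)

lemma esym_eq_0: "finite A \<Longrightarrow> card A < i \<Longrightarrow> esym A w i = 0"
proof (induction A arbitrary: i rule: finite_induct)
  case empty
  then show ?case by (cases i) (simp_all add: esym_empty)
next
  case (insert j A)
  then show ?case by (cases i) (simp_all add: esym_insert)
qed

text \<open>Vieta's formulas. Multiplication by \<open>x - w j\<close> matches the recursion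
  \<open>esym_insert\<close> after an index shift; the surplus top term vanishes by
  \<open>esym_eq_0\<close>.\<close>

lemma prod_eq_sum_esym:
  assumes "finite A"
  shows "(\<Prod>j\<in>A. x - w j) = (\<Sum>i\<le>card A. (- 1) ^ i * esym A w i * x ^ (card A - i))"
  using assms
proof (induction A rule: finite_induct)
  case empty
  then show ?case by simp
next
  case (insert j A)
  let ?n = "card A"
  have 1: "(\<Sum>i\<le>?n. (- 1) ^ i * esym A w i * x ^ (Suc ?n - i)) = x * (\<Sum>i\<le>?n. (- 1) ^ i * esym A w i * x ^ (?n - i))"
    unfolding sum_distrib_left by (intro sum.cong) (auto simp: Suc_diff_le)
  have "(\<Sum>i\<le>Suc ?n. (- 1) ^ i * esym (insert j A) w i * x ^ (Suc ?n - i)) =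
      x ^ Suc ?n + (\<Sum>i\<le>?n. (- 1) ^ Suc i * (esym A w (Suc i) + w j * esym A w i) * x ^ (?n - i))"
    by (subst sum.atMost_Suc_shift) (simp add: esym_insert insert)
  also have "\<dots> = (x ^ Suc ?n + (\<Sum>i\<le>?n. (- 1) ^ Suc i * esym A w (Suc i) * x ^ (?n - i)))
      - w j * (\<Sum>i\<le>?n. (- 1) ^ i * esym A w i * x ^ (?n - i))"
    unfolding sum_distrib_left add_diff_eq[symmetric] sum_subtractf[symmetric]
    by (intro arg_cong2[of _ _ _ _ "(+)"] sum.cong) (auto simp: algebra_simps)
  also have "x ^ Suc ?n + (\<Sum>i\<le>?n. (- 1) ^ Suc i * esym A w (Suc i) * x ^ (?n - i)) =
      (\<Sum>i\<le>Suc ?n. (- 1) ^ i * esym A w i * x ^ (Suc ?n - i))"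
    by (subst sum.atMost_Suc_shift) simp
  also have "\<dots> = x * (\<Sum>i\<le>?n. (- 1) ^ i * esym A w i * x ^ (?n - i))"
    using insert by (simp add: 1 esym_eq_0)
  finally show ?case using insert by (simp add: left_diff_distrib)
qed

text \<open>\<open>bounded_linear\<close> gives real linearity; compatibility with \<open>*s\<close>
  makes \<open>L\<close> complex-linear, hence a form of degree 1.\<close>

definition vlinear :: "(complex ^ 'n::finite \<Rightarrow> complex) \<Rightarrow> bool"
  where "vlinear L \<longleftrightarrow> bounded_linear L \<and> (\<forall>c v. L (c *s v) = c * L v)"

lemma vlinear_add: "vlinear f \<Longrightarrow> vlinear g \<Longrightarrow> vlinear (\<lambda>v. f v + g v)"
  by (auto simp: vlinear_def bounded_linear_add algebra_simps)

lemma vlinear_cmult: "vlinear f \<Longrightarrow> vlinear (\<lambda>v. c * f v)"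
  by (auto simp: vlinear_def bounded_linear_const_mult algebra_simps)

lemma vlinear_zero: "vlinear (\<lambda>v. 0)"
  by (simp add: vlinear_def)

lemma hform_vlinear:
  assumes "vlinear L"
  shows "hform 1 L"
proof -
  have lin: "linear L" using assms by (simp add: vlinear_def bounded_linear.linear)
  have "L v = (\<Sum>i\<in>UNIV. L (axis i 1) * v $ i)" for v
  proof -
    have "v = (\<Sum>i\<in>UNIV. v $ i *s axis i 1)" by (simp add: basis_expansion)
    then have "L v = (\<Sum>i\<in>UNIV. L (v $ i *s axis i 1))"
      using linear_sum[OF lin] by metis
    then show ?thesis using assms by (simp add: vlinear_def mult.commute)
  qed
  then have "L = (\<lambda>v. \<Sum>i\<in>UNIV. L (axis i 1) * v $ i)" by blast
  moreover have "hform 1 (\<lambda>v. \<Sum>i\<in>UNIV. L (axis i 1) * v $ i)"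
    by (intro hform_sum hform_cmult hform_component)
  ultimately show ?thesis by metis
qed

text \<open>A derivative of the form \<open>(a, b) \<mapsto> L (z *s a + b)\<close> encodes \<open>\<partial>z/\<partial>\<alpha>\<^sub>k = z \<partial>z/\<partial>\<beta>\<^sub>k\<close>.\<close>

lemma esym_shock_derivative:
  fixes z :: "'i \<Rightarrow> (complex ^ 'm::finite) \<times> (complex ^ 'm) \<Rightarrow> complex"
  assumes "finite A"
    and "\<forall>j\<in>A. vlinear (L j) \<and> (z j has_derivative (\<lambda>(a, b). L j (z j x *s a + b))) (at x)"
  shows "\<exists>X Y. (\<forall>i. ((\<lambda>y. esym A (\<lambda>j. z j y) i) has_derivative (\<lambda>(a, b). X i a + Y i b)) (at x)) \<and>
    (\<forall>i. vlinear (X i) \<and> vlinear (Y i)) \<and> (\<forall>v. X 0 v = 0 \<and> Y 0 v = 0) \<and>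
    (\<forall>i v. Y (Suc i) v = (\<Sum>j\<in>A. L j v) * esym A (\<lambda>j. z j x) i - X i v)"
  using assms
proof (induction A rule: finite_induct)
  case empty
  have "((\<lambda>y. esym {} (\<lambda>j. z j y) i) has_derivative (\<lambda>h. 0)) (at x)" for i
    by (cases i) (simp_all add: esym_empty)
  then show ?case
    by (intro exI[of _ "\<lambda>i v. 0"]) (auto simp: vlinear_zero)
next
  case (insert j A)
  have IH: "\<forall>j\<in>A. vlinear (L j) \<and> (z j has_derivative (\<lambda>(a, b). L j (z j x *s a + b))) (at x)"
    using insert.prems by blast
  obtain X Y where XY: "\<forall>i. ((\<lambda>y. esym A (\<lambda>j. z j y) i) has_derivative (\<lambda>(a, b). X i a + Y i b)) (at x)"
    "\<forall>i. vlinear (X i) \<and> vlinear (Y i)" "\<forall>v. X 0 v = 0 \<and> Y 0 v = 0"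
    "\<forall>i v. Y (Suc i) v = (\<Sum>j\<in>A. L j v) * esym A (\<lambda>j. z j x) i - X i v"
    using insert.IH[OF IH] by (elim exE conjE) (rule that)
  note X = XY(1)[rule_format] and lin = XY(2)[rule_format, THEN conjunct1] XY(2)[rule_format, THEN conjunct2]
    and X0 = XY(3)[rule_format, THEN conjunct1] XY(3)[rule_format, THEN conjunct2]
    and Y = XY(4)[rule_format]
  have Lj: "vlinear (L j)" and zj: "(z j has_derivative (\<lambda>(a, b). L j (z j x *s a + b))) (at x)"
    using insert by auto
  have Lj': "L j (z j x *s a + b) = z j x * L j a + L j b" for a b
    using Lj by (simp add: vlinear_def linear_add bounded_linear.linear)
  define E where "E i = esym A (\<lambda>j. z j x) i" for i
  \<comment> \<open>Product rule for \<open>esym A w (Suc i) + w j * esym A w i\<close>. The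
    differential of \<open>z j\<close> is \<open>z j x * L j a + L j b\<close>, so its
    \<open>a\<close>-part carries an extra factor \<open>z j x\<close>.\<close>
  define X' where "X' i = (case i of 0 \<Rightarrow> (\<lambda>v. 0)
    | Suc i \<Rightarrow> (\<lambda>v. X (Suc i) v + (z j x * X i v + (E i * z j x) * L j v)))" for i
  define Y' where "Y' i = (case i of 0 \<Rightarrow> (\<lambda>v. 0)
    | Suc i \<Rightarrow> (\<lambda>v. Y (Suc i) v + (z j x * Y i v + E i * L j v)))" for i
  have "((\<lambda>y. esym (insert j A) (\<lambda>j. z j y) i) has_derivative (\<lambda>(a, b). X' i a + Y' i b)) (at x)" for i
  proof (cases i)
    case 0
    have "(\<lambda>(a, b). X' 0 a + Y' 0 b) = (\<lambda>h. 0)" by (auto simp: X'_def Y'_def)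
    with 0 show ?thesis by simp
  next
    case (Suc i)
    have "((\<lambda>y. esym A (\<lambda>j. z j y) (Suc i) + z j y * esym A (\<lambda>j. z j y) i) has_derivative
      (\<lambda>h. (case h of (a, b) \<Rightarrow> X (Suc i) a + Y (Suc i) b) +
        (z j x * (case h of (a, b) \<Rightarrow> X i a + Y i b) +
         (case h of (a, b) \<Rightarrow> L j (z j x *s a + b)) * esym A (\<lambda>j. z j x) i))) (at x)"
      by (intro has_derivative_add has_derivative_mult X zj)
    moreover have "(\<lambda>h. (case h of (a, b) \<Rightarrow> X (Suc i) a + Y (Suc i) b) +
        (z j x * (case h of (a, b) \<Rightarrow> X i a + Y i b) +
         (case h of (a, b) \<Rightarrow> L j (z j x *s a + b)) * esym A (\<lambda>j. z j x) i)) =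
        (\<lambda>(a, b). X' (Suc i) a + Y' (Suc i) b)"
      by (rule ext, clarify, unfold prod.case Lj') (simp add: X'_def Y'_def E_def algebra_simps)
    ultimately show ?thesis using insert Suc by (simp add: esym_insert)
  qed
  moreover have "vlinear (X' i)" "vlinear (Y' i)" for i
    by (auto simp: X'_def Y'_def split: nat.split
        intro!: vlinear_zero vlinear_add vlinear_cmult lin Lj)
  \<comment> \<open>The terms with \<open>z j x * L j v\<close> cancel between the product and
    \<open>X' i v\<close>; this is where the special form of the differential of \<open>z j\<close>
    enters.\<close>
  moreover have "Y' (Suc i) v = (\<Sum>j\<in>insert j A. L j v) * esym (insert j A) (\<lambda>j. z j x) i - X' i v" for i v
  proof (cases i)
    case 0
    then show ?thesis using insert
      by (simp add: X'_def Y'_def Y E_def X0 algebra_simps)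
  next
    case (Suc k)
    then show ?thesis using insert
      by (simp add: X'_def Y'_def Y E_def esym_insert algebra_simps)
  qed
  ultimately show ?case by (intro exI[of _ X'] exI[of _ Y']) (auto simp: X'_def Y'_def)
qed

lemma scaleR_eq_smult: "t *\<^sub>R (v :: complex ^ 'n::finite) = of_real t *s v"
  unfolding vec_eq_iff by (simp add: scaleR_conv_of_real[where 'a = complex])

lemma coeff_sum_monom: "coeff (\<Sum>m\<le>N. monom (f m) m) k = (if k \<le> N then f k else 0)"
  by (simp add: coeff_sum)

lemma poly_sum_monom: "poly (\<Sum>m\<le>N. monom (f m) m) (t :: 'a::comm_semiring_1) = (\<Sum>m\<le>N. f m * t ^ m)"
  by (simp add: poly_sum poly_monom)

lemma has_vector_derivative_poly_of_real:
  "((\<lambda>s. poly p (of_real s :: complex)) has_vector_derivative poly (pderiv p) (of_real t)) (at t within S)"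
  using has_vector_derivative_real_field[OF poly_DERIV[of p "of_real t"]]
  by (rule has_vector_derivative_at_within)

section \<open>Polynomial dependence of the symmetric functions on \<open>\<beta>\<close>\<close>

text \<open>Only the differential equation of the last coordinates and the polynomial trace are kept
  from the geometry. \<open>H \<alpha> m\<close> is the part of degree \<open>m\<close> in
  \<open>\<beta>\<close> of the trace, and \<open>N\<close> stands for D + 1.\<close>

locale shock_waves =
  fixes A :: "'i set" and z :: "'i \<Rightarrow> (complex ^ 'm::finite) \<times> (complex ^ 'm) \<Rightarrow> complex"
    and \<epsilon> :: real and N :: nat and H :: "complex ^ 'm \<Rightarrow> nat \<Rightarrow> complex ^ 'm \<Rightarrow> complex"
  assumes A: "finite A" and \<epsilon>: "\<epsilon> > 0" and N: "N \<ge> 1"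
    and shock: "\<And>j \<alpha> \<beta>. j \<in> A \<Longrightarrow> norm \<alpha> < \<epsilon> \<Longrightarrow> norm \<beta> < \<epsilon> \<Longrightarrow>
      \<exists>L. vlinear L \<and> (z j has_derivative (\<lambda>(a, b). L (z j (\<alpha>, \<beta>) *s a + b))) (at (\<alpha>, \<beta>))"
    and hform_H: "\<And>\<alpha> m. norm \<alpha> < \<epsilon> \<Longrightarrow> hform m (H \<alpha> m)"
    and H_zero: "\<And>\<alpha> m v. norm \<alpha> < \<epsilon> \<Longrightarrow> m > N \<Longrightarrow> H \<alpha> m v = 0"
    and trace: "\<And>\<alpha> \<beta>. norm \<alpha> < \<epsilon> \<Longrightarrow> norm \<beta> < \<epsilon> \<Longrightarrow> (\<Sum>j\<in>A. z j (\<alpha>, \<beta>)) = (\<Sum>m\<le>N. H \<alpha> m \<beta>)"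
begin

definition e :: "nat \<Rightarrow> (complex ^ 'm) \<times> (complex ^ 'm) \<Rightarrow> complex"
  where "e i x = esym A (\<lambda>j. z j x) i"

definition dX :: "nat \<Rightarrow> complex ^ 'm \<Rightarrow> complex ^ 'm \<Rightarrow> complex ^ 'm \<Rightarrow> complex"
  where "dX i \<alpha> \<beta> a = frechet_derivative (e i) (at (\<alpha>, \<beta>)) (a, 0)"

definition dY :: "nat \<Rightarrow> complex ^ 'm \<Rightarrow> complex ^ 'm \<Rightarrow> complex ^ 'm \<Rightarrow> complex"
  where "dY i \<alpha> \<beta> b = frechet_derivative (e i) (at (\<alpha>, \<beta>)) (0, b)"

lemma e_derivative:
  assumes "norm \<alpha> < \<epsilon>" "norm \<beta> < \<epsilon>"
  shows "(e i has_derivative (\<lambda>(a, b). dX i \<alpha> \<beta> a + dY i \<alpha> \<beta> b)) (at (\<alpha>, \<beta>))"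
    and "vlinear (dX i \<alpha> \<beta>)" and "vlinear (dY i \<alpha> \<beta>)"
    and "dY (Suc i) \<alpha> \<beta> v = dY 1 \<alpha> \<beta> v * e i (\<alpha>, \<beta>) - dX i \<alpha> \<beta> v"
proof -
  have "\<exists>L. \<forall>j\<in>A. vlinear (L j) \<and> (z j has_derivative (\<lambda>(a, b). L j (z j (\<alpha>, \<beta>) *s a + b))) (at (\<alpha>, \<beta>))"
    using shock[OF _ assms] by (intro bchoice) blast
  then obtain L where L: "\<forall>j\<in>A. vlinear (L j) \<and>
      (z j has_derivative (\<lambda>(a, b). L j (z j (\<alpha>, \<beta>) *s a + b))) (at (\<alpha>, \<beta>))"
    by blast
  obtain X Y where XY: "\<forall>i. ((\<lambda>y. esym A (\<lambda>j. z j y) i) has_derivative (\<lambda>(a, b). X i a + Y i b)) (at (\<alpha>, \<beta>))"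
    "\<forall>i. vlinear (X i) \<and> vlinear (Y i)" "\<forall>v. X 0 v = 0 \<and> Y 0 v = 0"
    "\<forall>i v. Y (Suc i) v = (\<Sum>j\<in>A. L j v) * esym A (\<lambda>j. z j (\<alpha>, \<beta>)) i - X i v"
    using esym_shock_derivative[OF A L] by (elim exE conjE) (rule that)
  note der = XY(1)[rule_format] and lin = XY(2)[rule_format, THEN conjunct1] XY(2)[rule_format, THEN conjunct2]
    and X0 = XY(3)[rule_format, THEN conjunct1] and Y = XY(4)[rule_format]
  have e: "e i = (\<lambda>y. esym A (\<lambda>j. z j y) i)" for i by (rule ext) (simp add: e_def)
  have z: "X i 0 = 0" "Y i 0 = 0" for i
    using lin by (simp_all add: vlinear_def bounded_linear.linear linear_0)
  have dX: "dX i \<alpha> \<beta> = X i" and dY: "dY i \<alpha> \<beta> = Y i" for i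
    by (rule ext, simp add: dX_def dY_def e z flip: frechet_derivative_at[OF der])+
  show "(e i has_derivative (\<lambda>(a, b). dX i \<alpha> \<beta> a + dY i \<alpha> \<beta> b)) (at (\<alpha>, \<beta>))"
    "vlinear (dX i \<alpha> \<beta>)" "vlinear (dY i \<alpha> \<beta>)"
    using der lin by (simp_all add: dX dY e)
  \<comment> \<open>At index 0 the recursion for \<open>Y\<close> says that \<open>dY 1\<close> is
    the sum of the \<open>L j\<close>.\<close>
  show "dY (Suc i) \<alpha> \<beta> v = dY 1 \<alpha> \<beta> v * e i (\<alpha>, \<beta>) - dX i \<alpha> \<beta> v"
    by (simp add: dX dY e Y X0)
qed

lemma e_derivative_fst:
  assumes "norm \<alpha> < \<epsilon>" "norm \<beta> < \<epsilon>"
  shows "((\<lambda>a. e i (a, \<beta>)) has_derivative dX i \<alpha> \<beta>) (at \<alpha>)"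
proof -
  have "((\<lambda>a. (a, \<beta>)) has_derivative (\<lambda>a. (a, 0))) (at \<alpha>)"
    by (intro derivative_intros)
  from has_derivative_compose[OF this e_derivative(1)[OF assms]]
  have "((\<lambda>a. e i (a, \<beta>)) has_derivative (\<lambda>a. dX i \<alpha> \<beta> a + dY i \<alpha> \<beta> 0)) (at \<alpha>)"
    by simp
  moreover have "dY i \<alpha> \<beta> 0 = 0"
    using e_derivative(3)[OF assms] by (simp add: vlinear_def bounded_linear.linear linear_0)
  ultimately show ?thesis by simp
qed

lemma e_derivative_ray:
  assumes "norm \<alpha> < \<epsilon>" "norm (t *\<^sub>R \<beta>) < \<epsilon>"
  shows "((\<lambda>s. e i (\<alpha>, s *\<^sub>R \<beta>)) has_vector_derivative dY i \<alpha> (t *\<^sub>R \<beta>) \<beta>) (at t)"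
proof -
  have "((\<lambda>s. (\<alpha>, s *\<^sub>R \<beta>)) has_derivative (\<lambda>s. (0, s *\<^sub>R \<beta>))) (at t)"
    by (auto intro!: derivative_eq_intros)
  from has_derivative_compose[OF this e_derivative(1)[OF assms]]
  have "((\<lambda>s. e i (\<alpha>, s *\<^sub>R \<beta>)) has_derivative
      (\<lambda>s. dX i \<alpha> (t *\<^sub>R \<beta>) 0 + dY i \<alpha> (t *\<^sub>R \<beta>) (s *\<^sub>R \<beta>))) (at t)"
    by simp
  moreover have "dX i \<alpha> (t *\<^sub>R \<beta>) 0 = 0"
    using e_derivative(2)[OF assms] by (simp add: vlinear_def bounded_linear.linear linear_0)
  moreover have "dY i \<alpha> (t *\<^sub>R \<beta>) (s *\<^sub>R \<beta>) = s *\<^sub>R dY i \<alpha> (t *\<^sub>R \<beta>) \<beta>" for s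
    using e_derivative(3)[OF assms] by (simp add: vlinear_def bounded_linear.linear linear_cmul)
  ultimately show ?thesis by (simp add: has_vector_derivative_def)
qed

text \<open>The homogeneous parts in \<open>\<beta>\<close> of \<open>e i (\<alpha>, \<beta>)\<close>, obtained by integrating the recursion for
  the elementary symmetric functions along the rays \<open>t *\<^sub>R \<beta>\<close>.\<close>

primrec Q :: "nat \<Rightarrow> complex ^ 'm \<Rightarrow> nat \<Rightarrow> complex ^ 'm \<Rightarrow> complex" where
  "Q 0 = (\<lambda>\<alpha> m v. if m = 0 then 1 else 0)"
| "Q (Suc i) = (\<lambda>\<alpha> m v. case m of 0 \<Rightarrow> e (Suc i) (\<alpha>, 0)
    | Suc n \<Rightarrow> ((\<Sum>k\<le>n. of_nat (Suc k) * H \<alpha> (Suc k) v * Q i \<alpha> (n - k) v)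
        - frechet_derivative (\<lambda>a. Q i a n v) (at \<alpha>) v) / of_nat (Suc n))"

text \<open>The invariant of the induction over \<open>i\<close>; the degree bound grows by
  \<open>N\<close> in each step. Differentiability of \<open>Q i\<close> in \<open>\<alpha>\<close>
  follows from it by interpolation.\<close>

definition represented :: "nat \<Rightarrow> bool"
  where "represented i \<longleftrightarrow> (\<forall>\<alpha>. norm \<alpha> < \<epsilon> \<longrightarrow> (\<forall>m. hform m (Q i \<alpha> m)) \<and>
    (\<forall>m v. m > N * i \<longrightarrow> Q i \<alpha> m v = 0) \<and>
    (\<forall>\<beta>. norm \<beta> < \<epsilon> \<longrightarrow> e i (\<alpha>, \<beta>) = (\<Sum>m\<le>N * i. Q i \<alpha> m \<beta>)))"

lemma representedD:
  assumes "represented i" "norm \<alpha> < \<epsilon>"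
  shows "hform m (Q i \<alpha> m)" "m > N * i \<Longrightarrow> Q i \<alpha> m v = 0"
    "norm \<beta> < \<epsilon> \<Longrightarrow> e i (\<alpha>, \<beta>) = (\<Sum>m\<le>N * i. Q i \<alpha> m \<beta>)"
  using assms unfolding represented_def by blast+

text \<open>Points and weights are independent of \<open>\<alpha>\<close>, so differentiability in
  \<open>\<alpha>\<close> carries over from \<open>e i\<close> to its homogeneous parts.\<close>

lemma Q_interpolation:
  assumes "represented i"
  obtains R :: "('m \<Rightarrow> nat) set" and pt l where
    "finite R" "\<And>\<rho>. \<rho> \<in> R \<Longrightarrow> norm (pt \<rho> :: complex ^ 'm) < \<epsilon>" "\<And>\<rho> m. hform m (l \<rho> m)"
    "\<And>\<alpha> m v. norm \<alpha> < \<epsilon> \<Longrightarrow> m \<le> N * i \<Longrightarrow> Q i \<alpha> m v = (\<Sum>\<rho>\<in>R. e i (\<alpha>, pt \<rho>) * l \<rho> m v)"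
proof -
  obtain R :: "('m \<Rightarrow> nat) set" and pt :: "('m \<Rightarrow> nat) \<Rightarrow> complex ^ 'm" and l
    where R: "finite R" "\<And>\<rho>. \<rho> \<in> R \<Longrightarrow> norm (pt \<rho>) < \<epsilon>" and l: "\<And>\<rho> m. hform m (l \<rho> m)"
    and int: "\<And>Q m v. (\<And>j. hform j (Q j)) \<Longrightarrow> m \<le> N * i \<Longrightarrow>
       Q m v = (\<Sum>\<rho>\<in>R. (\<Sum>j\<le>N * i. Q j (pt \<rho>)) * l \<rho> m v)"
    by (rule hform_interpolation[OF \<epsilon>, where N = "N * i" and 'n = 'm]) blast
  show thesis
  proof (rule that[OF R l])
    fix \<alpha> v :: "complex ^ 'm" and m assume "norm \<alpha> < \<epsilon>" "m \<le> N * i"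
    then show "Q i \<alpha> m v = (\<Sum>\<rho>\<in>R. e i (\<alpha>, pt \<rho>) * l \<rho> m v)"
      using int[of "Q i \<alpha>" m v] representedD[OF assms] R(2) by simp
  qed
qed

text \<open>The interpolation formula is differentiated in \<open>\<alpha>\<close>. In
  \<open>dQ m v v\<close> the vector \<open>v\<close> is both the \<open>\<beta>\<close>-argument
  and the direction of differentiation; the linear factor \<open>dX i\<close> raises the degree to
  \<open>Suc m\<close>.\<close>

lemma Q_derivative:
  assumes i: "represented i" and \<alpha>: "norm \<alpha> < \<epsilon>"
  obtains dQ where "\<And>m v. ((\<lambda>a. Q i a m v) has_derivative dQ m v) (at \<alpha>)"
    "\<And>m. hform (Suc m) (\<lambda>v. dQ m v v)"
    "\<And>m v a. m > N * i \<Longrightarrow> dQ m v a = 0"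
    "\<And>\<beta> a. norm \<beta> < \<epsilon> \<Longrightarrow> dX i \<alpha> \<beta> a = (\<Sum>m\<le>N * i. dQ m \<beta> a)"
    "\<And>m c v a. dQ m (c *s v) a = c ^ m * dQ m v a"
proof -
  obtain R :: "('m \<Rightarrow> nat) set" and pt l where
    R: "finite R" "\<And>\<rho>. \<rho> \<in> R \<Longrightarrow> norm (pt \<rho> :: complex ^ 'm) < \<epsilon>" and l: "\<And>\<rho> m. hform m (l \<rho> m)"
    and Q: "\<And>\<alpha> m v. norm \<alpha> < \<epsilon> \<Longrightarrow> m \<le> N * i \<Longrightarrow> Q i \<alpha> m v = (\<Sum>\<rho>\<in>R. e i (\<alpha>, pt \<rho>) * l \<rho> m v)"
    by (rule Q_interpolation[OF i]) blast
  define dQ where "dQ m v a = (if m \<le> N * i then \<Sum>\<rho>\<in>R. dX i \<alpha> (pt \<rho>) a * l \<rho> m v else 0)" for m v a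
  have op: "open (ball 0 \<epsilon> :: (complex ^ 'm) set)" "\<alpha> \<in> ball 0 \<epsilon>" using \<alpha> by auto
  have der: "((\<lambda>a. Q i a m v) has_derivative dQ m v) (at \<alpha>)" for m v
  proof (cases "m \<le> N * i")
    case True
    have "((\<lambda>a. \<Sum>\<rho>\<in>R. e i (a, pt \<rho>) * l \<rho> m v) has_derivative
        (\<lambda>a. \<Sum>\<rho>\<in>R. dX i \<alpha> (pt \<rho>) a * l \<rho> m v)) (at \<alpha>)"
      by (intro has_derivative_sum has_derivative_mult_left e_derivative_fst R(2) \<alpha>)
    then have "((\<lambda>a. \<Sum>\<rho>\<in>R. e i (a, pt \<rho>) * l \<rho> m v) has_derivative dQ m v) (at \<alpha>)"
      using True by (simp add: dQ_def[abs_def])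
    then show ?thesis
      by (rule has_derivative_transform_within_open[OF _ op]) (use Q True in auto)
  next
    case False
    have "((\<lambda>a. 0) has_derivative dQ m v) (at \<alpha>)"
      using False by (simp add: dQ_def[abs_def])
    then show ?thesis
      by (rule has_derivative_transform_within_open[OF _ op])
        (use representedD(2)[OF i] False in auto)
  qed
  show thesis
  proof (rule that[OF der])
    show "hform (Suc m) (\<lambda>v. dQ m v v)" for m
    proof (cases "m \<le> N * i")
      case True
      have "hform (1 + m) (\<lambda>v. dX i \<alpha> (pt \<rho>) v * l \<rho> m v)" if "\<rho> \<in> R" for \<rho>
        by (intro hform_mult hform_vlinear l e_derivative(2) \<alpha> R(2) that)
      then show ?thesis using True by (simp add: dQ_def hform_sum)
    next
      case False
      then show ?thesis by (simp add: dQ_def hform_zero)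
    qed
    show "dQ m v a = 0" if "m > N * i" for m v a using that by (simp add: dQ_def)
    show "dQ m (c *s v) a = c ^ m * dQ m v a" for m c v a
      unfolding dQ_def sum_distrib_left by (simp add: hform_smult[OF l] sum_distrib_left mult_ac)
    show "dX i \<alpha> \<beta> a = (\<Sum>m\<le>N * i. dQ m \<beta> a)" if \<beta>: "norm \<beta> < \<epsilon>" for \<beta> a
    proof -
      have "((\<lambda>a. \<Sum>m\<le>N * i. Q i a m \<beta>) has_derivative (\<lambda>a. \<Sum>m\<le>N * i. dQ m \<beta> a)) (at \<alpha>)"
        by (intro has_derivative_sum der)
      then have "((\<lambda>a. e i (a, \<beta>)) has_derivative (\<lambda>a. \<Sum>m\<le>N * i. dQ m \<beta> a)) (at \<alpha>)"
        by (rule has_derivative_transform_within_open[OF _ op])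
          (use representedD(3)[OF i _ \<beta>] in auto)
      from has_derivative_unique[OF this e_derivative_fst[OF \<alpha> \<beta>]]
      show ?thesis by (simp add: fun_eq_iff)
    qed
  qed
qed

text \<open>By homogeneity the trace along the ray \<open>s *\<^sub>R \<beta>\<close> is the
  polynomial in \<open>s\<close> with coefficients \<open>H \<alpha> m \<beta>\<close>.\<close>

lemma dY_1_ray:
  assumes \<alpha>: "norm \<alpha> < \<epsilon>" and t: "norm (t *\<^sub>R \<beta>) < \<epsilon>"
  shows "dY 1 \<alpha> (t *\<^sub>R \<beta>) \<beta> = poly (pderiv (\<Sum>m\<le>N. monom (H \<alpha> m \<beta>) m)) (of_real t)"
proof -
  let ?p = "\<Sum>m\<le>N. monom (H \<alpha> m \<beta>) m"
  let ?S = "{s. norm (s *\<^sub>R \<beta>) < \<epsilon>}"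
  have "open ?S" by (intro open_Collect_less continuous_intros)
  moreover have "e 1 (\<alpha>, s *\<^sub>R \<beta>) = poly ?p (of_real s)" if "s \<in> ?S" for s
    using that trace[OF \<alpha>, of "s *\<^sub>R \<beta>"] A
    by (simp add: e_def esym_1 poly_sum_monom scaleR_eq_smult hform_smult[OF hform_H[OF \<alpha>]] mult.commute)
  ultimately have "((\<lambda>s. e 1 (\<alpha>, s *\<^sub>R \<beta>)) has_vector_derivative poly (pderiv ?p) (of_real t)) (at t)"
    using t by (intro has_vector_derivative_transform_within_open[OF has_vector_derivative_poly_of_real, of ?S]) auto
  with e_derivative_ray[OF assms] show ?thesis by (rule vector_derivative_unique_at)
qed

lemma represented_0: "represented 0"
  unfolding represented_def
proof (intro allI impI conjI)
  fix \<alpha> :: "complex ^ 'm" and m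
  show "hform m (Q 0 \<alpha> m)"
    by (cases m) (simp_all add: hform_const hform_zero)
qed (auto simp: e_def)

text \<open>On the ray through \<open>\<beta>\<close> the relation between consecutive symmetric
  functions is an ordinary differential equation with polynomial right-hand side.
  \<open>Q (Suc i)\<close> integrates it coefficientwise, starting from the value at
  \<open>\<beta> = 0\<close>.\<close>

lemma represented_Suc:
  assumes i: "represented i"
  shows "represented (Suc i)"
  unfolding represented_def
proof (intro allI impI)
  fix \<alpha> :: "complex ^ 'm" assume \<alpha>: "norm \<alpha> < \<epsilon>"
  obtain dQ where dQ: "\<And>m v. ((\<lambda>a. Q i a m v) has_derivative dQ m v) (at \<alpha>)"
    "\<And>m. hform (Suc m) (\<lambda>v. dQ m v v)"
    "\<And>m v a. m > N * i \<Longrightarrow> dQ m v a = 0"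
    "\<And>\<beta> a. norm \<beta> < \<epsilon> \<Longrightarrow> dX i \<alpha> \<beta> a = (\<Sum>m\<le>N * i. dQ m \<beta> a)"
    "\<And>m c v a. dQ m (c *s v) a = c ^ m * dQ m v a"
    by (rule Q_derivative[OF i \<alpha>]) blast
  have fd: "frechet_derivative (\<lambda>a. Q i a n v) (at \<alpha>) = dQ n v" for n v
    using frechet_derivative_at[OF dQ(1)] by simp
  have Q0: "Q (Suc i) \<alpha> 0 = (\<lambda>v. e (Suc i) (\<alpha>, 0))" by simp
  have QS: "Q (Suc i) \<alpha> (Suc n) = (\<lambda>v. (1 / of_nat (Suc n)) *
      ((\<Sum>k\<le>n. of_nat (Suc k) * (H \<alpha> (Suc k) v * Q i \<alpha> (n - k) v)) + (- 1) * dQ n v v))" for n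
    by (rule ext) (simp add: fd mult.assoc)
  have form: "hform m (Q (Suc i) \<alpha> m)" for m
  proof (cases m)
    case 0
    then show ?thesis unfolding 0 Q0 by (intro hform_const)
  next
    case (Suc n)
    have "hform (Suc n) (\<lambda>v. H \<alpha> (Suc k) v * Q i \<alpha> (n - k) v)" if "k \<le> n" for k
      using hform_mult[OF hform_H[OF \<alpha>] representedD(1)[OF i \<alpha>], of "Suc k" "n - k"] that by simp
    then show ?thesis unfolding Suc QS
      by (intro hform_cmult hform_add hform_sum dQ(2)) auto
  qed
  \<comment> \<open>Degree count: \<open>H \<alpha> (Suc k)\<close> can be nonzero only for
    \<open>Suc k \<le> N\<close>, and then \<open>n - k > N * i\<close>. The derivative term drops
    out since \<open>n > N * i\<close>, by \<open>N \<ge> 1\<close>.\<close>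
  moreover have zero: "Q (Suc i) \<alpha> m v = 0" if m: "m > N * Suc i" for m v
  proof -
    obtain n where n: "m = Suc n" "n \<ge> N * Suc i" using m by (cases m) auto
    have "H \<alpha> (Suc k) v * Q i \<alpha> (n - k) v = 0" if "k \<le> n" for k
    proof (cases "Suc k > N")
      case True
      then show ?thesis using H_zero[OF \<alpha>] by simp
    next
      case False
      then have "n - k > N * i" using n by auto
      then show ?thesis using representedD(2)[OF i \<alpha>] by simp
    qed
    then have "(\<Sum>k\<le>n. of_nat (Suc k) * (H \<alpha> (Suc k) v * Q i \<alpha> (n - k) v)) = 0"
      by (intro sum.neutral ballI) (metis atMost_iff mult_zero_right)
    moreover have "dQ n v v = 0" using n N by (intro dQ(3)) auto
    ultimately show ?thesis unfolding n QS by (simp only: mult_zero_right add_0_right)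
  qed
  moreover have "e (Suc i) (\<alpha>, \<beta>) = (\<Sum>m\<le>N * Suc i. Q (Suc i) \<alpha> m \<beta>)" if \<beta>: "norm \<beta> < \<epsilon>" for \<beta>
  proof -
    \<comment> \<open>Polynomials in the ray parameter that describe, in this order, the trace,
      \<open>e i\<close>, the \<open>\<alpha>\<close>-differential of \<open>e i\<close> in
      direction \<open>\<beta>\<close>, and the proposed \<open>e (Suc i)\<close>.\<close>
    define pH where "pH = (\<Sum>m\<le>N. monom (H \<alpha> m \<beta>) m)"
    define pQ where "pQ = (\<Sum>m\<le>N * i. monom (Q i \<alpha> m \<beta>) m)"
    define pD where "pD = (\<Sum>m\<le>N * i. monom (dQ m \<beta> \<beta>) m)"
    define pS where "pS = (\<Sum>m\<le>N * Suc i. monom (Q (Suc i) \<alpha> m \<beta>) m)"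
    have cH: "coeff pH k = H \<alpha> k \<beta>" and cQ: "coeff pQ k = Q i \<alpha> k \<beta>"
      and cD: "coeff pD k = dQ k \<beta> \<beta>" and cS: "coeff pS k = Q (Suc i) \<alpha> k \<beta>" for k
      unfolding pH_def pQ_def pD_def pS_def coeff_sum_monom
      using H_zero[OF \<alpha>] representedD(2)[OF i \<alpha>] dQ(3) zero by auto
    \<comment> \<open>Coefficient by coefficient this is the recursion defining
      \<open>Q\<close>.\<close>
    have pderiv_S: "pderiv pS = pderiv pH * pQ - pD"
    proof (rule poly_eqI)
      fix n
      show "coeff (pderiv pS) n = coeff (pderiv pH * pQ - pD) n"
        unfolding coeff_diff coeff_mult coeff_pderiv cS cH cQ cD QS by (simp add: mult.assoc del: of_nat_Suc)
    qed
    have ray: "norm (t *\<^sub>R \<beta>) < \<epsilon>" if "t \<in> {0..1}" for t :: real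
      using that \<beta> mult_right_mono[of t 1 "norm \<beta>"] by auto
    have "((\<lambda>s. e (Suc i) (\<alpha>, s *\<^sub>R \<beta>) - poly pS (of_real s)) has_vector_derivative 0) (at t within {0..1})"
      if t: "t \<in> {0..1}" for t
    proof -
      let ?b = "t *\<^sub>R \<beta>"
      note b = ray[OF t]
      have "dX i \<alpha> ?b \<beta> = poly pD (of_real t)"
        using dQ(4)[OF b] by (simp add: pD_def poly_sum_monom scaleR_eq_smult dQ(5) mult.commute)
      moreover have "e i (\<alpha>, ?b) = poly pQ (of_real t)"
        using representedD(3)[OF i \<alpha> b] hform_smult[OF representedD(1)[OF i \<alpha>]]
        by (simp add: pQ_def poly_sum_monom scaleR_eq_smult mult.commute)
      moreover have "dY 1 \<alpha> ?b \<beta> = poly (pderiv pH) (of_real t)"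
        unfolding pH_def by (rule dY_1_ray[OF \<alpha> b])
      ultimately have "dY (Suc i) \<alpha> ?b \<beta> = poly (pderiv pS) (of_real t)"
        unfolding e_derivative(4)[OF \<alpha> b] pderiv_S by simp
      then have "((\<lambda>s. e (Suc i) (\<alpha>, s *\<^sub>R \<beta>)) has_vector_derivative poly (pderiv pS) (of_real t)) (at t within {0..1})"
        using has_vector_derivative_at_within[OF e_derivative_ray[OF \<alpha> b]] by metis
      from has_vector_derivative_diff[OF this has_vector_derivative_poly_of_real[of pS]]
      show ?thesis by simp
    qed
    then obtain c where c: "\<And>s. s \<in> {0..1::real} \<Longrightarrow> e (Suc i) (\<alpha>, s *\<^sub>R \<beta>) - poly pS (of_real s) = c"
      using has_vector_derivative_zero_constant[of "{0..1}" "\<lambda>s. e (Suc i) (\<alpha>, s *\<^sub>R \<beta>) - poly pS (of_real s)"]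
      by auto
    \<comment> \<open>At \<open>s = 0\<close> both terms equal
      \<open>e (Suc i) (\<alpha>, 0)\<close>, the degree 0 part of \<open>Q (Suc i)\<close>.\<close>
    have "c = 0" using c[of 0] cS[of 0] by (simp add: poly_0_coeff_0)
    then have "e (Suc i) (\<alpha>, \<beta>) = poly pS 1" using c[of 1] by simp
    then show ?thesis by (simp add: pS_def poly_sum_monom del: mult_Suc_right)
  qed
  ultimately show "(\<forall>m. hform m (Q (Suc i) \<alpha> m)) \<and> (\<forall>m v. N * Suc i < m \<longrightarrow> Q (Suc i) \<alpha> m v = 0) \<and>
      (\<forall>\<beta>. norm \<beta> < \<epsilon> \<longrightarrow> e (Suc i) (\<alpha>, \<beta>) = (\<Sum>m\<le>N * Suc i. Q (Suc i) \<alpha> m \<beta>))"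
    by blast
qed

lemma represented: "represented i"
  by (induction i) (intro represented_0 represented_Suc)+

lemma Q_recursion:
  "of_nat (Suc n) * Q (Suc i) \<alpha> (Suc n) v = (\<Sum>k\<le>n. of_nat (Suc k) * H \<alpha> (Suc k) v * Q i \<alpha> (n - k) v)
     - frechet_derivative (\<lambda>a. Q i a n v) (at \<alpha>) v"
  by (simp del: of_nat_Suc)

text \<open>\<open>Q 0\<close> is concentrated in degree 0 and constant in \<open>\<alpha>\<close>,
  so only the term \<open>k = n\<close> of the recursion survives.\<close>

lemma Q_1:
  assumes "norm \<alpha> < \<epsilon>"
  shows "Q 1 \<alpha> (Suc n) v = H \<alpha> (Suc n) v"
proof -
  have "(\<Sum>k\<le>n. of_nat (Suc k) * H \<alpha> (Suc k) v * Q 0 \<alpha> (n - k) v) =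
      (\<Sum>k\<le>n. if k = n then of_nat (Suc n) * H \<alpha> (Suc n) v else 0)"
    by (intro sum.cong) auto
  then have "of_nat (Suc n) * Q 1 \<alpha> (Suc n) v = of_nat (Suc n) * H \<alpha> (Suc n) v"
    using Q_recursion[of n 0 \<alpha> v] by (simp del: of_nat_Suc Q.simps(2) add: frechet_derivative_const)
  then show ?thesis by (simp only: mult_cancel_left of_nat_eq_0_iff nat.simps simp_thms)
qed

text \<open>Beyond the number of waves \<open>e i\<close> is identically zero, and its homogeneous
  parts are combinations of its values.\<close>

lemma Q_eq_0: "card A < i \<Longrightarrow> norm \<alpha> < \<epsilon> \<Longrightarrow> Q i \<alpha> m v = 0"
proof (cases "m \<le> N * i")
  case True
  assume i: "card A < i" and \<alpha>: "norm \<alpha> < \<epsilon>"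
  show ?thesis
    by (rule Q_interpolation[OF represented[of i]]) (use \<alpha> True esym_eq_0[OF A i] in \<open>simp add: e_def\<close>)
qed (use representedD(2)[OF represented] in auto)

text \<open>In top degree the recursion for the last nonzero \<open>Q i\<close> reads
  \<open>0 = N H\<^sub>N Q\<^sub>M\<close>: the \<open>\<alpha>\<close>-derivative cannot raise the degree in \<open>\<beta>\<close>, while multiplication
  by the \<open>\<beta>\<close>-derivative of the trace does as soon as \<open>N > 1\<close>.\<close>

lemma trace_degree_le_1:
  assumes \<alpha>: "norm \<alpha> < \<epsilon>" and nz: "H \<alpha> N v \<noteq> 0"
  shows "N = 1"
proof (rule ccontr)
  assume "N \<noteq> 1"
  with N have N2: "N \<ge> 2" by simp
  \<comment> \<open>The top part of the trace is nonzero at \<open>v\<close> on all of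
    \<open>W\<close>. Openness of \<open>W\<close> lets identities valid on it be differentiated in
    \<open>\<alpha>\<close>.\<close>
  define W where "W = {a. norm a < \<epsilon> \<and> Q 1 a N v \<noteq> 0}"
  have "continuous_on (ball 0 \<epsilon>) (\<lambda>a. Q 1 a N v)"
  proof (rule continuous_at_imp_continuous_on, rule ballI)
    fix a :: "complex ^ 'm" assume "a \<in> ball 0 \<epsilon>"
    then have a: "norm a < \<epsilon>" by simp
    show "isCont (\<lambda>a. Q 1 a N v) a"
      by (rule Q_derivative[OF represented[of 1] a]) (rule has_derivative_continuous)
  qed
  then have "open (ball 0 \<epsilon> \<inter> (\<lambda>a. Q 1 a N v) -` (- {0}))"
    by (intro continuous_open_preimage) auto
  moreover have "ball 0 \<epsilon> \<inter> (\<lambda>a. Q 1 a N v) -` (- {0}) = W" by (auto simp: W_def)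
  ultimately have W: "open W" by simp
  have WB: "norm a < \<epsilon>" if "a \<in> W" for a using that by (simp add: W_def)
  have \<alpha>W: "\<alpha> \<in> W" using \<alpha> nz Q_1[OF \<alpha>, of "N - 1"] N by (simp add: W_def del: Q.simps)
  \<comment> \<open>Nonvanishing is tested in the single direction \<open>v\<close> but over all of
    \<open>W\<close>, so everything beyond the maximal \<open>i\<close>, and later beyond the
    maximal degree \<open>M\<close>, vanishes on an open set of \<open>\<alpha>\<close>.\<close>
  define I where "I = {i. \<exists>a\<in>W. \<exists>m. Q i a m v \<noteq> 0}"
  have "I \<subseteq> {..card A}" using Q_eq_0 WB unfolding I_def by (force simp: not_less[symmetric])
  then have finI: "finite I" using finite_subset by blast
  have "1 \<in> I" using \<alpha>W by (auto simp: I_def W_def simp del: Q.simps)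
  define i where "i = Max I"
  have "i \<in> I" unfolding i_def using finI \<open>1 \<in> I\<close> Max_in by blast
  have "Suc i \<notin> I" using Max_ge[OF finI, of "Suc i"] by (auto simp: i_def)
  define J where "J = {m. \<exists>a\<in>W. Q i a m v \<noteq> 0}"
  have "J \<subseteq> {..N * i}"
    using representedD(2)[OF represented] WB unfolding J_def by (force simp: not_less[symmetric])
  then have finJ: "finite J" using finite_subset by blast
  have "J \<noteq> {}" using \<open>i \<in> I\<close> by (auto simp: I_def J_def)
  define M where "M = Max J"
  have "M \<in> J" unfolding M_def using finJ \<open>J \<noteq> {}\<close> Max_in by blast
  then obtain a where a: "a \<in> W" "Q i a M v \<noteq> 0" by (auto simp: J_def)
  have above: "Q i b m v = 0" if "b \<in> W" "m > M" for b m
    using Max_ge[OF finJ, of m] that by (auto simp: J_def M_def)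
  \<comment> \<open>As \<open>N \<ge> 2\<close>, this exceeds \<open>M\<close>, so
    \<open>Q i b n v\<close> vanishes throughout \<open>W\<close> together with its derivative. In
    the recursion at \<open>Suc n\<close> the degrees of the two factors add up to N + M, which
    leaves only top part times top part.\<close>
  define n where "n = M + (N - 1)"
  have "((\<lambda>b. 0) has_derivative (\<lambda>h. 0)) (at a)" by (rule has_derivative_const)
  then have "((\<lambda>b. Q i b n v) has_derivative (\<lambda>h. 0)) (at a)"
    by (rule has_derivative_transform_within_open[OF _ W a(1)])
      (use above N2 in \<open>auto simp: n_def\<close>)
  then have fd: "frechet_derivative (\<lambda>b. Q i b n v) (at a) v = 0"
    using frechet_derivative_at by metis
  have "Q (Suc i) a (Suc n) v = 0" using \<open>Suc i \<notin> I\<close> a(1) by (auto simp: I_def simp del: Q.simps)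
  then have "(\<Sum>k\<le>n. of_nat (Suc k) * H a (Suc k) v * Q i a (n - k) v) = 0"
    using Q_recursion[of n i a v] fd by (simp del: of_nat_Suc Q.simps)
  also have "(\<Sum>k\<le>n. of_nat (Suc k) * H a (Suc k) v * Q i a (n - k) v) =
      (\<Sum>k\<le>n. if k = N - 1 then of_nat N * H a N v * Q i a M v else 0)"
  proof (rule sum.cong)
    fix k assume k: "k \<in> {..n}"
    consider "k = N - 1" | "k > N - 1" | "k < N - 1" by linarith
    then show "of_nat (Suc k) * H a (Suc k) v * Q i a (n - k) v =
        (if k = N - 1 then of_nat N * H a N v * Q i a M v else 0)"
    proof cases
      case 1
      then show ?thesis using N by (simp add: n_def del: of_nat_Suc)
    next
      case 2
      then show ?thesis using H_zero[OF WB[OF a(1)], of "Suc k" v] by simp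
    next
      case 3
      then have "n - k > M" by (simp add: n_def)
      then show ?thesis using above[OF a(1)] 3 by simp
    qed
  qed simp
  also have "\<dots> = of_nat N * H a N v * Q i a M v" by (simp add: n_def)
  finally have "H a N v = 0" using a(2) N by simp
  then show False using a(1) Q_1[OF WB[OF a(1)], of "N - 1" v] N by (simp add: W_def del: Q.simps)
qed

end

section \<open>Polynomials along lines and as formal objects\<close>

text \<open>The interior of the zero set is closed in \<open>U\<close>: in a ball around a limit
  point, a complex line joins some interior zero \<open>y\<close> to any \<open>w\<close>, and the
  one-variable identity theorem on the convex slice \<open>T\<close> carries the zeros near
  \<open>y\<close> over to \<open>w\<close>. Connectedness of \<open>U\<close> concludes.\<close>

lemma mv_holomorphic_identity:
  assumes f: "mv_holomorphic_on f U" and U: "connected U"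
    and V: "open V" "V \<noteq> {}" "V \<subseteq> U" "\<And>x. x \<in> V \<Longrightarrow> f x = 0" and x: "x \<in> U"
  shows "f x = 0"
proof -
  have opU: "open U" using f by (simp add: mv_holomorphic_on_def)
  define Z where "Z = interior {x \<in> U. f x = 0}"
  have ZU: "Z \<subseteq> U" and Z0: "\<And>x. x \<in> Z \<Longrightarrow> f x = 0"
    using interior_subset[of "{x \<in> U. f x = 0}"] by (auto simp: Z_def)
  have "V \<subseteq> Z" unfolding Z_def using V by (intro interior_maximal) auto
  have "closedin (top_of_set U) Z"
    unfolding closedin_limpt
  proof (intro conjI ZU allI impI)
    fix x assume "x islimpt Z \<and> x \<in> U"
    then have x: "x \<in> closure Z" "x \<in> U" by (auto simp: closure_def)
    obtain r where r: "r > 0" "ball x r \<subseteq> U" using opU x(2) open_contains_ball by blast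
    obtain y where y: "y \<in> Z" "dist y x < r" using x(1) r(1) closure_approachable by blast
    have "f w = 0" if w: "w \<in> ball x r" for w
    proof -
      define c where "c t = y + t *s (w - y)" for t :: complex
      define T where "T = c -` ball x r"
      have cd: "(c has_derivative (\<lambda>h. h *s (w - y))) (at t)" for t
      proof -
        have "((\<lambda>t. t *s (w - y)) has_derivative (\<lambda>h. h *s (w - y))) (at t)"
          by (intro bounded_linear_imp_has_derivative
              bounded_bilinear.bounded_linear_left[OF bounded_bilinear_smult_vec])
        from has_derivative_add[OF has_derivative_const this, of y] show ?thesis
          unfolding c_def by simp
      qed
      have contc: "continuous_on UNIV c"
        using cd by (auto intro!: continuous_at_imp_continuous_on dest: has_derivative_continuous)
      have opT: "open T" unfolding T_def using contc by (intro open_vimage) auto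
      have "convex T"
      proof (rule convexI)
        fix s t :: complex and u v :: real
        assume st: "s \<in> T" "t \<in> T" and uv: "0 \<le> u" "0 \<le> v" "u + v = 1"
        have "u *\<^sub>R y + v *\<^sub>R y = y" using uv(3) by (metis scaleR_left_distrib scaleR_one)
        then have "c (u *\<^sub>R s + v *\<^sub>R t) = u *\<^sub>R c s + v *\<^sub>R c t"
          by (simp add: c_def scaleR_eq_smult scaleR_conv_of_real vec_eq_iff algebra_simps)
        moreover have "u *\<^sub>R c s + v *\<^sub>R c t \<in> ball x r"
          using st uv convex_ball[of x r] by (intro convexD) (auto simp: T_def)
        ultimately show "u *\<^sub>R s + v *\<^sub>R t \<in> T" by (simp add: T_def)
      qed
      have hol: "(\<lambda>t. f (c t)) holomorphic_on T"
        unfolding holomorphic_on_open[OF opT]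
      proof
        fix t assume "t \<in> T"
        then have "c t \<in> U" using r by (auto simp: T_def)
        then obtain f' where f': "(f has_derivative f') (at (c t))" "\<And>c v. f' (c *s v) = c * f' v"
          using f by (auto simp: mv_holomorphic_on_def)
        have "((\<lambda>t. f (c t)) has_derivative (\<lambda>h. f' (w - y) * h)) (at t)"
          using has_derivative_compose[OF cd f'(1)] by (simp only: f'(2) mult.commute)
        then show "\<exists>f'. ((\<lambda>t. f (c t)) has_field_derivative f') (at t)"
          unfolding has_field_derivative_def by blast
      qed
      have "open (T \<inter> c -` Z)"
        unfolding Z_def using contc opT by (intro open_Int open_vimage) auto
      moreover have "0 \<in> T \<inter> c -` Z" using y by (auto simp: T_def c_def dist_commute)
      moreover have "1 \<in> T" using w by (simp add: T_def c_def)
      ultimately have "f (c 1) = 0"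
        using analytic_continuation_open[of "T \<inter> c -` Z" T "\<lambda>t. f (c t)" "\<lambda>t. 0" 1]
          opT hol convex_connected[OF \<open>convex T\<close>] Z0 by auto
      then show ?thesis by (simp add: c_def)
    qed
    then have "ball x r \<subseteq> Z" unfolding Z_def using r by (intro interior_maximal) auto
    then show "x \<in> Z" using r(1) by auto
  qed
  moreover have "openin (top_of_set U) Z"
    using ZU by (auto simp: openin_open_eq[OF opU] Z_def)
  ultimately have "Z = {} \<or> Z = U" using U connected_clopen by blast
  then show ?thesis using \<open>V \<subseteq> Z\<close> V(2) x Z0 by auto
qed

section \<open>Restriction of forms to affine lines\<close>

lemma coeff_mult_degree_le:
  fixes p q :: "'a::comm_semiring_0 poly"
  assumes "degree p \<le> m" "degree q \<le> n"
  shows "coeff (p * q) (m + n) = coeff p m * coeff q n"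
proof -
  have "coeff (p * q) (m + n) = (\<Sum>i\<le>m + n. if i = m then coeff p m * coeff q n else 0)"
    unfolding coeff_mult
  proof (rule sum.cong)
    fix i assume "i \<in> {..m + n}"
    consider "i = m" | "i < m" | "i > m" by linarith
    then show "coeff p i * coeff q (m + n - i) = (if i = m then coeff p m * coeff q n else 0)"
      by cases (use assms in \<open>auto simp: coeff_eq_0\<close>)
  qed simp
  then show ?thesis by simp
qed

text \<open>The coefficient of t^m is independent of the base point \<open>b\<close>: it is the
  value of the form at the direction \<open>u\<close>, the point at infinity of the line.\<close>

definition restricts_to :: "nat \<Rightarrow> complex ^ 'n::finite \<Rightarrow> complex ^ 'n \<Rightarrow> (complex ^ 'n \<Rightarrow> complex) \<Rightarrow> bool"
  where "restricts_to m u b Q \<longleftrightarrow>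
    (\<exists>p. degree p \<le> m \<and> coeff p m = Q u \<and> (\<forall>t. poly p t = Q (t *s u + b)))"

lemma restricts_to_mult:
  assumes "restricts_to m u b P" "restricts_to n u b Q"
  shows "restricts_to (m + n) u b (\<lambda>x. P x * Q x)"
proof -
  obtain p q where "degree p \<le> m" "coeff p m = P u" "\<forall>t. poly p t = P (t *s u + b)"
    "degree q \<le> n" "coeff q n = Q u" "\<forall>t. poly q t = Q (t *s u + b)"
    using assms unfolding restricts_to_def by blast
  then show ?thesis unfolding restricts_to_def
    by (intro exI[of _ "p * q"]) (auto simp: coeff_mult_degree_le intro: order.trans[OF degree_mult_le])
qed

lemma restricts_to_power: "restricts_to m u b P \<Longrightarrow> restricts_to (k * m) u b (\<lambda>x. P x ^ k)"
proof (induction k)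
  case 0
  show ?case unfolding restricts_to_def by (rule exI[of _ 1]) auto
next
  case (Suc k)
  then show ?case using restricts_to_mult[of m u b P "k * m" "\<lambda>x. P x ^ k"] by simp
qed

lemma restricts_to_vmonom: "restricts_to (\<Sum>i\<in>UNIV. k i) u b (vmonom k)"
proof -
  have "restricts_to 1 u b (\<lambda>x. x $ i)" for i
    unfolding restricts_to_def by (rule exI[of _ "[:b $ i, u $ i:]"]) auto
  then have comp: "restricts_to (k i) u b (\<lambda>x. (x $ i) ^ k i)" for i
    using restricts_to_power[of 1 u b "\<lambda>x. x $ i" "k i"] by simp
  have "restricts_to (\<Sum>i\<in>I. k i) u b (\<lambda>x. \<Prod>i\<in>I. (x $ i) ^ k i)" if "finite I" for I
    using that
  proof (induction I rule: finite_induct)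
    case empty
    show ?case unfolding restricts_to_def by (rule exI[of _ 1]) auto
  next
    case (insert i I)
    then show ?case using restricts_to_mult[OF comp] by simp
  qed
  then show ?thesis unfolding vmonom_def[abs_def] by simp
qed

lemma restricts_to_hform:
  assumes "hform m Q"
  shows "restricts_to m u b Q"
proof -
  obtain c where c: "\<And>x. Q x = (\<Sum>k\<in>exponents m. c k * vmonom k x)"
    using assms by (auto simp: hform_def)
  have "\<exists>p. \<forall>k\<in>exponents m. degree (p k) \<le> m \<and> coeff (p k) m = vmonom k u \<and>
      (\<forall>t. poly (p k) t = vmonom k (t *s u + b))"
    using restricts_to_vmonom[of _ u b] by (intro bchoice) (auto simp: restricts_to_def exponents_def)
  then obtain p where p: "\<And>k. k \<in> exponents m \<Longrightarrow> degree (p k) \<le> m"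
    "\<And>k. k \<in> exponents m \<Longrightarrow> coeff (p k) m = vmonom k u"
    "\<And>k t. k \<in> exponents m \<Longrightarrow> poly (p k) t = vmonom k (t *s u + b)"
    by blast
  show ?thesis unfolding restricts_to_def
  proof (intro exI[of _ "\<Sum>k\<in>exponents m. smult (c k) (p k)"] conjI allI)
    show "degree (\<Sum>k\<in>exponents m. smult (c k) (p k)) \<le> m"
      using p(1) by (intro degree_sum_le finite_exponents) (auto intro: order.trans[OF degree_smult_le])
  qed (simp_all add: coeff_sum poly_sum p c)
qed

text \<open>Forms of degree below \<open>d\<close> do not reach the coefficient of t^d, which is
  therefore \<open>F d u\<close>. The difference of the two sides has degree at most
  \<open>d\<close>, coefficient 0 at t^d, and \<open>d\<close> distinct zeros, so it is
  zero.\<close>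

lemma sum_hforms_line:
  assumes F: "\<And>m. hform m (F m)" and r: "inj_on r {1..d}"
    and 0: "\<And>j. j \<in> {1..d} \<Longrightarrow> (\<Sum>m\<le>d. F m (r j *s u + b)) = 0"
  shows "(\<Sum>m\<le>d. F m (t *s u + b)) = F d u * (\<Prod>j\<in>{1..d}. t - r j)"
proof -
  have "\<exists>p. \<forall>m. degree (p m) \<le> m \<and> coeff (p m) m = F m u \<and> (\<forall>t. poly (p m) t = F m (t *s u + b))"
    using restricts_to_hform[OF F, of _ u b] by (intro choice) (simp add: restricts_to_def)
  then obtain p where p: "\<And>m. degree (p m) \<le> m" "\<And>m. coeff (p m) m = F m u"
    "\<And>m t. poly (p m) t = F m (t *s u + b)" by blast
  define P where "P = (\<Sum>m\<le>d. p m)"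
  define R where "R = (\<Prod>j\<in>{1..d}. [:- r j, 1:])"
  have poly_P: "poly P t = (\<Sum>m\<le>d. F m (t *s u + b))" for t by (simp add: P_def poly_sum p)
  have "degree P \<le> d" unfolding P_def by (intro degree_sum_le) (auto intro: order.trans[OF p(1)])
  have "coeff P d = (\<Sum>m\<le>d. if m = d then F d u else 0)"
    unfolding P_def coeff_sum
    by (intro sum.cong) (use p le_less_trans in \<open>auto intro!: coeff_eq_0 le_neq_implies_less[THEN le_less_trans[rotated]]\<close>)
  then have "coeff P d = F d u" by simp
  have degR: "degree R = d" unfolding R_def by (subst degree_prod_eq_sum_degree) auto
  have "coeff R d = 1" using lead_coeff_prod[of "\<lambda>j. [:- r j, 1:]" "{1..d}"] degR by (simp add: R_def)
  define S where "S = P - smult (F d u) R"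
  have "S = 0"
  proof (rule ccontr)
    assume S: "S \<noteq> 0"
    have "r ` {1..d} \<subseteq> {x. poly S x = 0}"
    proof clarify
      fix j assume j: "j \<in> {1..d}"
      have "poly R (r j) = 0" unfolding R_def poly_prod by (rule prod_zero) (use j in auto)
      then show "poly S (r j) = 0" using 0[OF j] by (simp add: S_def poly_P)
    qed
    then have "card (r ` {1..d}) \<le> card {x. poly S x = 0}"
      using poly_roots_finite[OF S] card_mono by blast
    then have "d \<le> degree S" using card_poly_roots_bound[OF S] r by (simp add: card_image)
    moreover have "degree S \<le> d" unfolding S_def
      using \<open>degree P \<le> d\<close> degR by (intro degree_diff_le order.trans[OF degree_smult_le]) auto
    ultimately have "lead_coeff S = coeff S d" by simp
    also have "\<dots> = 0" by (simp add: S_def \<open>coeff P d = F d u\<close> \<open>coeff R d = 1\<close>)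
    finally show False using S by simp
  qed
  then have "P = smult (F d u) R" by (simp add: S_def)
  then show ?thesis using poly_P[of t] by (simp add: R_def poly_prod)
qed

text \<open>Passage to formal coefficients: the one at an exponent is taken from the form of its
  total degree. Nonvanishing of \<open>F d u\<close> yields a monomial of degree exactly
  \<open>d\<close>.\<close>

lemma cpoly_of_hforms:
  fixes F :: "nat \<Rightarrow> complex ^ 'v::finite \<Rightarrow> complex"
  assumes F: "\<And>m. hform m (F m)" and nz: "F d u \<noteq> 0"
  obtains P :: "'v cpoly" where "\<And>x. cpoly_eval P x = (\<Sum>m\<le>d. F m x)" "cpoly_degree P = d"
proof -
  have "\<exists>c. \<forall>m x. F m x = (\<Sum>k\<in>exponents m. c m k * vmonom k x)"
    using F unfolding hform_def by (intro choice) blast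
  then obtain c where c: "\<And>m x. F m x = (\<Sum>k\<in>exponents m. c m k * vmonom k x)" by blast
  define deg :: "('v \<Rightarrow>\<^sub>0 nat) \<Rightarrow> nat" where "deg m = (\<Sum>i\<in>UNIV. Poly_Mapping.lookup m i)" for m
  define S where "S = {m. deg m \<le> d}"
  have bij: "bij_betw Poly_Mapping.lookup S (multi_indices_le d)"
    unfolding S_def deg_def multi_indices_le_def
    by (rule bij_betw_byWitness[of _ Abs_poly_mapping]) (auto simp: poly_mapping.lookup_inverse)
  then have finS: "finite S" using bij_betw_finite finite_multi_indices_le by blast
  define f where "f m = (if deg m \<le> d then c (deg m) (Poly_Mapping.lookup m) else 0)" for m
  have "finite {m. f m \<noteq> 0}" by (rule finite_subset[OF _ finS]) (auto simp: f_def S_def)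
  then have lkf: "Poly_Mapping.lookup (Abs_poly_mapping f) = f" by simp
  let ?P = "Abs_poly_mapping f"
  have keys: "Poly_Mapping.keys ?P \<subseteq> S" by (auto simp: in_keys_iff lkf f_def S_def split: if_splits)
  show thesis
  proof (rule that[of ?P])
    fix x
    have "cpoly_eval ?P x = (\<Sum>m\<in>S. f m * vmonom (Poly_Mapping.lookup m) x)"
      unfolding cpoly_eval_def lkf vmonom_def
      by (rule sum.mono_neutral_left[OF finS keys]) (auto simp: in_keys_iff lkf)
    also have "\<dots> = (\<Sum>m\<in>S. c (\<Sum>i\<in>UNIV. Poly_Mapping.lookup m i) (Poly_Mapping.lookup m) * vmonom (Poly_Mapping.lookup m) x)"
      by (rule sum.cong) (auto simp: f_def S_def deg_def)
    also have "\<dots> = (\<Sum>k\<in>multi_indices_le d. c (\<Sum>i\<in>UNIV. k i) k * vmonom k x)"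
      by (rule sum.reindex_bij_betw[OF bij])
    also have "\<dots> = (\<Sum>m\<le>d. F m x)"
      unfolding sum_multi_indices_le c by (intro sum.cong) (auto simp: exponents_def)
    finally show "cpoly_eval ?P x = (\<Sum>m\<le>d. F m x)" .
  next
    have "\<exists>k\<in>exponents d. c d k \<noteq> 0"
      using nz unfolding c by (auto dest: sum.not_neutral_contains_not_neutral)
    then obtain k where k: "k \<in> exponents d" "c d k \<noteq> 0" by blast
    have lk: "Poly_Mapping.lookup (Abs_poly_mapping k) = k" by simp
    have dk: "deg (Abs_poly_mapping k) = d" using k by (simp add: deg_def lk exponents_def)
    have "Abs_poly_mapping k \<in> Poly_Mapping.keys ?P" using k dk by (simp add: in_keys_iff lkf f_def lk)
    then show "cpoly_degree ?P = d"
      unfolding cpoly_degree_def deg_def[symmetric] using keys dk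
      by (intro Max_eqI) (auto simp: S_def image_iff)
  qed
qed

lemma hform_lift:
  assumes "hform m Q"
  shows "hform m (\<lambda>\<zeta> :: complex ^ 'm::finite option. Q (\<chi> k. \<zeta> $ Some k))"
proof -
  obtain c where c: "\<And>x. Q x = (\<Sum>k\<in>exponents m. c k * vmonom k x)"
    using assms by (auto simp: hform_def)
  have "hform m (\<lambda>\<zeta> :: complex ^ 'm option. vmonom k (\<chi> i. \<zeta> $ Some i))" if "k \<in> exponents m" for k
  proof -
    have "vmonom (case_option 0 k) = (\<lambda>\<zeta> :: complex ^ 'm option. vmonom k (\<chi> i. \<zeta> $ Some i))"
      by (rule ext) (simp add: vmonom_def UNIV_option_conv prod.reindex)
    moreover have "(\<Sum>i\<in>UNIV. case_option 0 k i) = m"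
      using that by (simp add: exponents_def UNIV_option_conv sum.reindex)
    ultimately show ?thesis using hform_vmonom[of "case_option 0 k"] by simp
  qed
  then show ?thesis unfolding c by (intro hform_sum hform_cmult)
qed

lemma hform_power: "hform m P \<Longrightarrow> hform (k * m) (\<lambda>x. P x ^ k)"
proof (induction k)
  case 0
  show ?case using hform_const[of 1] by simp
next
  case (Suc k)
  then show ?case using hform_mult[of m P "k * m" "\<lambda>x. P x ^ k"] by simp
qed

lemma eventually_nhds_pair_0:
  assumes "eventually P (nhds (0 :: 'a::real_normed_vector, 0 :: 'b::real_normed_vector))"
  obtains \<epsilon> where "\<epsilon> > 0" "\<And>a b. norm a < \<epsilon> \<Longrightarrow> norm b < \<epsilon> \<Longrightarrow> P (a, b)"
proof -
  obtain r where r: "r > 0" "\<And>x. dist x (0, 0) < r \<Longrightarrow> P x"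
    using assms by (auto simp: eventually_nhds_metric)
  show thesis
  proof (rule that[of "r / 2"])
    fix a :: 'a and b :: 'b assume "norm a < r / 2" "norm b < r / 2"
    moreover have "norm (a, b) \<le> norm a + norm b" by (rule norm_Pair_le)
    ultimately show "P (a, b)" using r(2)[of "(a, b)"] by (simp add: dist_norm)
  qed (use r in simp)
qed

section \<open>The polynomial vanishing on the hypersurfaces\<close>

text \<open>The identity theorem on the connected set \<open>U\<close> moves a point of nonvanishing
  into the range of small \<open>\<alpha>\<close>.\<close>

lemma coefficient_nonzero_near_0:
  fixes h :: "complex ^ 'm::finite \<Rightarrow> complex"
  assumes "mv_holomorphic_on h U" "connected U" "0 \<in> U" "\<alpha>1 \<in> U" "h \<alpha>1 \<noteq> 0" "\<epsilon> > 0"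
  obtains \<alpha> where "norm \<alpha> < \<epsilon>" "h \<alpha> \<noteq> 0"
proof -
  have "open U" using assms(1) by (simp add: mv_holomorphic_on_def)
  then have "open (ball 0 \<epsilon> \<inter> U)" by auto
  moreover have "ball 0 \<epsilon> \<inter> U \<noteq> {}" using assms by force
  ultimately have "\<exists>x\<in>ball 0 \<epsilon> \<inter> U. h x \<noteq> 0"
    using mv_holomorphic_identity[OF assms(1,2), of "ball 0 \<epsilon> \<inter> U" \<alpha>1] assms(4,5) by auto
  then show thesis using that by auto
qed

theorem proposition5p3:
  fixes \<gamma> :: "nat \<Rightarrow> (complex ^ ('m::finite) option) set"
    and p :: "nat \<Rightarrow> complex ^ 'm \<Rightarrow> complex ^ 'm \<Rightarrow> complex ^ 'm option"
    and h :: "('m \<Rightarrow> nat) \<Rightarrow> complex ^ 'm \<Rightarrow> complex"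
    and U :: "(complex ^ 'm) set"
    and d D :: nat
  assumes hypersurfaces: "\<forall>j\<in>{1..d}. smooth_hypersurface (\<gamma> j)"
    and disjoint: "disjoint_family_on \<gamma> {1..d}"
    and intersections: "\<forall>\<^sub>F (\<alpha>, \<beta>) in nhds (0, 0). \<forall>j\<in>{1..d}.
          affine_line \<alpha> \<beta> \<inter> \<gamma> j = {p j \<alpha> \<beta>} \<and>
          transversal_at (affine_line \<alpha> \<beta>) (\<gamma> j) (p j \<alpha> \<beta>)"
    and U: "open U" "connected U" "0 \<in> U"
    and analytic: "\<forall>k\<in>multi_indices_le (D + 1). mv_holomorphic_on (h k) U"
    and nonzero: "\<exists>k. (\<Sum>i\<in>UNIV. k i) = D + 1 \<and> (\<exists>\<alpha>\<in>U. h k \<alpha> \<noteq> 0)"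
    and trace: "\<forall>\<^sub>F (\<alpha>, \<beta>) in nhds (0, 0).
          (\<Sum>j\<in>{1..d}. p j \<alpha> \<beta> $ None) =
          (\<Sum>k\<in>multi_indices_le (D + 1). h k \<alpha> * (\<Prod>i\<in>UNIV. (\<beta> $ i) ^ k i))"
  shows "\<exists>(P :: 'm option cpoly) \<epsilon> \<kappa> K.
      cpoly_degree P = d + D \<and> \<epsilon> > 0 \<and> \<kappa> > 0 \<and> K > 0 \<and>
      (\<forall>\<zeta>\<in>line_tube \<epsilon>. norm \<zeta> \<ge> K \<longrightarrow> cmod (cpoly_eval P \<zeta>) \<ge> \<kappa> * norm \<zeta> ^ d) \<and>
      (\<forall>\<alpha> \<beta>. max (norm \<alpha>) (norm \<beta>) < \<epsilon> \<longrightarrow>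
         affine_line \<alpha> \<beta> \<inter> zero_set P = (\<lambda>j. p j \<alpha> \<beta>) ` {1..d})"
proof -
  note One_nat_def [simp del]
  define z where "z j x = p j (fst x) (snd x) $ None" for j x
  define H where "H \<alpha> m \<beta> = (if m \<le> D + 1 then \<Sum>k\<in>exponents m. h k \<alpha> * vmonom k \<beta> else 0)" for \<alpha> m \<beta>
  \<comment> \<open>Differentiation at a nearby point requires the intersection property on a whole
    neighbourhood of that point, hence the nested quantifier.\<close>
  have "\<forall>\<^sub>F x in nhds (0, 0).
      (\<forall>\<^sub>F (\<alpha>, \<beta>) in nhds x. \<forall>j\<in>{1..d}. affine_line \<alpha> \<beta> \<inter> \<gamma> j = {p j \<alpha> \<beta>} \<and>
        transversal_at (affine_line \<alpha> \<beta>) (\<gamma> j) (p j \<alpha> \<beta>)) \<and>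
      (case x of (\<alpha>, \<beta>) \<Rightarrow> (\<Sum>j\<in>{1..d}. p j \<alpha> \<beta> $ None) =
          (\<Sum>k\<in>multi_indices_le (D + 1). h k \<alpha> * (\<Prod>i\<in>UNIV. (\<beta> $ i) ^ k i)))"
    using eventually_conj[OF iffD2[OF eventually_eventually intersections] trace] .
  then obtain \<epsilon> where \<epsilon>: "\<epsilon> > 0" and near: "\<And>\<alpha> \<beta>. norm \<alpha> < \<epsilon> \<Longrightarrow> norm \<beta> < \<epsilon> \<Longrightarrow>
      \<forall>\<^sub>F (a, b) in nhds (\<alpha>, \<beta>). \<forall>j\<in>{1..d}. affine_line a b \<inter> \<gamma> j = {p j a b} \<and>
        transversal_at (affine_line a b) (\<gamma> j) (p j a b)"
    and tr: "\<And>\<alpha> \<beta>. norm \<alpha> < \<epsilon> \<Longrightarrow> norm \<beta> < \<epsilon> \<Longrightarrow> (\<Sum>j\<in>{1..d}. p j \<alpha> \<beta> $ None) =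
          (\<Sum>k\<in>multi_indices_le (D + 1). h k \<alpha> * (\<Prod>i\<in>UNIV. (\<beta> $ i) ^ k i))"
    by (rule eventually_nhds_pair_0) auto
  have inter: "affine_line \<alpha> \<beta> \<inter> \<gamma> j = {p j \<alpha> \<beta>}" "transversal_at (affine_line \<alpha> \<beta>) (\<gamma> j) (p j \<alpha> \<beta>)"
    if "norm \<alpha> < \<epsilon>" "norm \<beta> < \<epsilon>" "j \<in> {1..d}" for \<alpha> \<beta> j
    using eventually_nhds_x_imp_x[OF near[OF that(1,2)]] that(3) by auto
  have p_line: "p j \<alpha> \<beta> = vjoin (z j (\<alpha>, \<beta>) *s \<alpha> + \<beta>) (z j (\<alpha>, \<beta>))"
    if "norm \<alpha> < \<epsilon>" "norm \<beta> < \<epsilon>" "j \<in> {1..d}" for \<alpha> \<beta> j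
    using inter(1)[OF that] mem_affine_line_iff[of "p j \<alpha> \<beta>" \<alpha> \<beta>] by (auto simp: z_def)

  \<comment> \<open>Reduction to shock waves and degree of the trace\<close>
  interpret shock_waves "{1..d}" z \<epsilon> "D + 1" H
  proof
    fix j and \<alpha> \<beta> :: "complex ^ 'm"
    assume j: "j \<in> {1..d}" and ab: "norm \<alpha> < \<epsilon>" "norm \<beta> < \<epsilon>"
    have ev: "\<forall>\<^sub>F (a, b) in nhds (\<alpha>, \<beta>). affine_line a b \<inter> \<gamma> j = {p j a b}"
      using near[OF ab] by eventually_elim (use j in auto)
    obtain L where "bounded_linear L" "\<And>c v. L (c *s v) = c * L v"
      "((\<lambda>(a, b). p j a b $ None) has_derivative (\<lambda>(a, b). L (p j \<alpha> \<beta> $ None *s a + b))) (at (\<alpha>, \<beta>))"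
      by (rule intersection_point_derivative[of "\<gamma> j" \<alpha> \<beta> "p j"])
        (use hypersurfaces inter(2)[OF ab j] ev j in auto)
    moreover have "(\<lambda>(a, b). p j a b $ None) = z j" by (auto simp: z_def)
    ultimately show "\<exists>L. vlinear L \<and> (z j has_derivative (\<lambda>(a, b). L (z j (\<alpha>, \<beta>) *s a + b))) (at (\<alpha>, \<beta>))"
      by (intro exI[of _ L]) (auto simp: vlinear_def z_def)
  next
    fix \<alpha> :: "complex ^ 'm" and m
    show "hform m (H \<alpha> m)"
    proof (cases "m \<le> D + 1")
      case True
      then show ?thesis unfolding hform_def H_def by (intro exI[of _ "\<lambda>k. h k \<alpha>"]) simp
    next
      case False
      then have "H \<alpha> m = (\<lambda>\<beta>. 0)" by (auto simp: H_def)
      then show ?thesis by (simp add: hform_zero)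
    qed
  next
    fix \<alpha> \<beta> :: "complex ^ 'm"
    assume "norm \<alpha> < \<epsilon>" "norm \<beta> < \<epsilon>"
    from tr[OF this] show "(\<Sum>j\<in>{1..d}. z j (\<alpha>, \<beta>)) = (\<Sum>m\<le>D + 1. H \<alpha> m \<beta>)"
      by (simp add: sum_multi_indices_le H_def z_def vmonom_def)
  qed (use \<epsilon> in \<open>auto simp: H_def\<close>)

  have D0: "D = 0"
  proof -
    obtain k \<alpha>1 where k: "k \<in> exponents (D + 1)" "\<alpha>1 \<in> U" "h k \<alpha>1 \<noteq> 0"
      using nonzero by (auto simp: exponents_def)
    have "mv_holomorphic_on (h k) U"
      using analytic k(1) by (auto simp: exponents_def multi_indices_le_def)
    from coefficient_nonzero_near_0[OF this U(2,3) k(2,3) \<epsilon>]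
    obtain \<alpha> where \<alpha>: "norm \<alpha> < \<epsilon>" "h k \<alpha> \<noteq> 0" .
    then obtain v where "(\<Sum>k\<in>exponents (D + 1). h k \<alpha> * vmonom k v) \<noteq> 0"
      using hform_eq_0D[OF _ k(1), of "\<lambda>k. h k \<alpha>"] by blast
    then have "H \<alpha> (D + 1) v \<noteq> 0" by (simp add: H_def)
    from trace_degree_le_1[OF \<alpha>(1) this] show ?thesis by simp
  qed

  \<comment> \<open>Construction of the polynomial\<close>
  \<comment> \<open>\<open>c i l\<close> is the part of degree \<open>l + (d - i)\<close> of the
    Vieta term (-1)^i e_i \<zeta>_n^(d-i), with e_i taken at \<open>\<alpha> = 0\<close>. As
    \<open>D = 0\<close>, e_i has degree at most \<open>i\<close> in \<open>\<beta>\<close>; hence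
    \<open>l \<le> i\<close> in \<open>F\<close>, and total degree at most \<open>d\<close>.\<close>
  define c where "c i m \<zeta> = (- 1) ^ i * Q i 0 m (\<chi> k. \<zeta> $ Some k) * (\<zeta> $ None) ^ (d - i)"
    for i m and \<zeta> :: "complex ^ 'm option"
  define F where "F m \<zeta> = (\<Sum>i\<le>d. \<Sum>l\<le>i. if l + (d - i) = m then c i l \<zeta> else 0)"
    for m and \<zeta> :: "complex ^ 'm option"
  have Q0: "hform m (Q i 0 m)" for i m using representedD(1)[OF represented] \<epsilon> by simp
  have F: "hform m (F m)" for m
  proof -
    have "hform (l + (d - i)) (c i l)" for i l
    proof -
      have "hform (l + (d - i) * 1) (\<lambda>\<zeta>. ((- 1) ^ i * Q i 0 l (\<chi> k. \<zeta> $ Some k)) * (\<zeta> $ None) ^ (d - i))"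
        by (intro hform_mult hform_cmult hform_lift Q0 hform_power hform_component)
      then show ?thesis by (simp add: c_def[abs_def])
    qed
    then have "hform m (\<lambda>\<zeta>. if l + (d - i) = m then c i l \<zeta> else 0)" for i l
      by (cases "l + (d - i) = m") (auto simp: hform_zero)
    then show ?thesis unfolding F_def by (intro hform_sum)
  qed
  have sum_F: "(\<Sum>m\<le>d. F m (vjoin b t)) = (\<Prod>j\<in>{1..d}. t - z j (0, b))" if b: "norm b < \<epsilon>" for b t
  proof -
    have "(\<Sum>m\<le>d. F m \<zeta>) = (\<Sum>i\<le>d. \<Sum>l\<le>i. c i l \<zeta>)" for \<zeta>
    proof -
      have "(\<Sum>m\<le>d. F m \<zeta>) = (\<Sum>i\<le>d. \<Sum>l\<le>i. \<Sum>m\<le>d. if l + (d - i) = m then c i l \<zeta> else 0)"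
        unfolding F_def by (subst sum.swap, rule sum.cong[OF refl], rule sum.swap)
      also have "\<dots> = (\<Sum>i\<le>d. \<Sum>l\<le>i. c i l \<zeta>)"
        by (intro sum.cong refl) (auto simp: sum.delta)
      finally show ?thesis .
    qed
    then have "(\<Sum>m\<le>d. F m (vjoin b t)) = (\<Sum>i\<le>d. (- 1) ^ i * (\<Sum>l\<le>i. Q i 0 l b) * t ^ (d - i))"
      by (simp add: c_def sum_distrib_left sum_distrib_right)
    also have "\<dots> = (\<Sum>i\<le>d. (- 1) ^ i * esym {1..d} (\<lambda>j. z j (0, b)) i * t ^ (d - i))"
    proof (intro sum.cong refl)
      fix i
      have "e i (0, b) = (\<Sum>l\<le>i. Q i 0 l b)"
        using representedD(3)[OF represented, of 0 b i] \<epsilon> b D0 by simp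
      from this[unfolded e_def] show "(- 1) ^ i * (\<Sum>l\<le>i. Q i 0 l b) * t ^ (d - i) =
          (- 1) ^ i * esym {1..d} (\<lambda>j. z j (0, b)) i * t ^ (d - i)"
        by (simp only:)
    qed
    also have "\<dots> = (\<Prod>j\<in>{1..d}. t - z j (0, b))"
      using prod_eq_sum_esym[of "{1..d}" t "\<lambda>j. z j (0, b)"] by simp
    finally show ?thesis .
  qed
  \<comment> \<open>Degree \<open>d\<close> forces \<open>l = i\<close>, and forms of positive
    degree vanish at 0, so only the monomial \<zeta>_n^d contributes.\<close>
  have F_top: "F d (vjoin 0 1) = 1"
  proof -
    have "(\<chi> k. vjoin (0 :: complex ^ 'm) 1 $ Some k) = 0" by (simp add: vec_eq_iff)
    then have "(if l + (d - i) = d then c i l (vjoin 0 1) else 0) = (if l = 0 then if i = 0 then 1 else 0 else 0)"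
      if "i \<le> d" for i l
      using that hform_zero_at_0[OF Q0, of l i] by (cases "l = 0") (auto simp: c_def)
    then have "F d (vjoin 0 1) = (\<Sum>i\<le>d. \<Sum>l\<le>i. if l = 0 then if i = 0 then 1 else 0 else 0)"
      unfolding F_def by (intro sum.cong refl) auto
    then show ?thesis by simp
  qed
  obtain P :: "'m option cpoly" where P: "\<And>\<zeta>. cpoly_eval P \<zeta> = (\<Sum>m\<le>d. F m \<zeta>)" "cpoly_degree P = d"
    using cpoly_of_hforms[of F d "vjoin 0 1"] F F_top by auto

  \<comment> \<open>Choice of the radius\<close>
  define M where "M = (\<Sum>j\<in>{1..d}. cmod (z j (0, 0))) + 1"
  have M: "M \<ge> 1" by (simp add: M_def sum_nonneg)
  have "\<forall>\<^sub>F x in nhds (0, 0). \<forall>j\<in>{1..d}. cmod (z j x) < M"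
  proof (intro eventually_ball_finite ballI)
    fix j assume j: "j \<in> {1..d}"
    have "isCont (z j) (0, 0)" using shock[OF j, of 0 0] \<epsilon> has_derivative_continuous by fastforce
    moreover have "cmod (z j (0, 0)) < M"
      using member_le_sum[of j "{1..d}" "\<lambda>j. cmod (z j (0, 0))"] j by (simp add: M_def)
    ultimately have "\<forall>\<^sub>F x in at (0, 0). cmod (z j x) < M"
      by (intro order_tendstoD(2)[OF tendsto_norm]) (auto simp: isCont_def)
    then show "\<forall>\<^sub>F x in nhds (0, 0). cmod (z j x) < M"
      using \<open>cmod (z j (0, 0)) < M\<close> by (simp add: eventually_nhds_conv_at)
  qed simp
  then obtain \<epsilon>1 where \<epsilon>1: "\<epsilon>1 > 0"
    "\<And>\<alpha> \<beta>. norm \<alpha> < \<epsilon>1 \<Longrightarrow> norm \<beta> < \<epsilon>1 \<Longrightarrow> \<forall>j\<in>{1..d}. cmod (z j (\<alpha>, \<beta>)) < M"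
    by (rule eventually_nhds_pair_0) blast
  have "continuous_on UNIV (\<lambda>\<alpha> :: complex ^ 'm. F d (vjoin \<alpha> 1))"
  proof -
    have eq: "(\<lambda>\<alpha> :: complex ^ 'm. vjoin \<alpha> 1) = (\<lambda>\<alpha>. vjoin \<alpha> 0 + vjoin 0 1)"
      by (intro ext vec_option_eqI) auto
    have "continuous_on UNIV (\<lambda>\<alpha> :: complex ^ 'm. vjoin \<alpha> 1)"
      unfolding eq by (intro continuous_on_add linear_continuous_on bounded_linear_vjoin_0 continuous_on_const)
    from continuous_on_compose2[OF continuous_on_hform[OF F, of UNIV] this] show ?thesis by auto
  qed
  then have "isCont (\<lambda>\<alpha> :: complex ^ 'm. F d (vjoin \<alpha> 1)) 0"
    by (simp add: continuous_on_eq_continuous_at)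
  then have "\<forall>\<^sub>F \<alpha> in at (0 :: complex ^ 'm). cmod (F d (vjoin \<alpha> 1)) > 1 / 2"
    by (intro order_tendstoD(1)[OF tendsto_norm]) (auto simp: isCont_def F_top)
  then have "\<forall>\<^sub>F \<alpha> in nhds (0 :: complex ^ 'm). cmod (F d (vjoin \<alpha> 1)) > 1 / 2"
    by (simp add: eventually_nhds_conv_at F_top)
  then obtain \<epsilon>2 where \<epsilon>2: "\<epsilon>2 > 0"
    "\<And>\<alpha> :: complex ^ 'm. norm \<alpha> < \<epsilon>2 \<Longrightarrow> cmod (F d (vjoin \<alpha> 1)) > 1 / 2"
    by (auto simp: eventually_nhds_metric dist_norm)
  \<comment> \<open>With roots bounded by \<open>M\<close>, the bound
    \<open>\<epsilon> / (M + 1)\<close> keeps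
    \<open>z j (\<alpha>, \<beta>) *s \<alpha> + \<beta>\<close> below \<open>\<epsilon>\<close> in
    norm, so the line with first parameter 0 through \<open>p j \<alpha> \<beta>\<close> is still
    admissible. The bound 1 serves the growth estimate.\<close>
  define \<epsilon>0 where "\<epsilon>0 = min (min \<epsilon> (\<epsilon> / (M + 1))) (min (min \<epsilon>1 \<epsilon>2) 1)"
  have \<epsilon>0: "\<epsilon>0 \<le> \<epsilon>" "\<epsilon>0 \<le> \<epsilon> / (M + 1)" "\<epsilon>0 \<le> \<epsilon>1" "\<epsilon>0 \<le> \<epsilon>2" "\<epsilon>0 \<le> 1"
    by (auto simp: \<epsilon>0_def)
  have \<epsilon>0_pos: "\<epsilon>0 > 0" using \<epsilon> \<epsilon>1(1) \<epsilon>2(1) M by (simp add: \<epsilon>0_def)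
  have \<epsilon>0_M: "\<epsilon>0 * (M + 1) \<le> \<epsilon>" using \<epsilon>0(2) M by (simp add: pos_le_divide_eq)

  \<comment> \<open>Factorization along lines\<close>
  have factor: "cpoly_eval P (vjoin (t *s \<alpha> + \<beta>) t) = F d (vjoin \<alpha> 1) * (\<Prod>j\<in>{1..d}. t - z j (\<alpha>, \<beta>))"
    if \<alpha>: "norm \<alpha> < \<epsilon>0" and \<beta>: "norm \<beta> < \<epsilon>0" for \<alpha> \<beta> t
  proof -
    have ab: "norm \<alpha> < \<epsilon>" "norm \<beta> < \<epsilon>" using \<alpha> \<beta> \<epsilon>0 by auto
    have line: "vjoin (t *s \<alpha> + \<beta>) t = t *s vjoin \<alpha> 1 + vjoin \<beta> 0" for t
      by (rule vec_option_eqI) auto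
    \<comment> \<open>Equal last coordinates on one line mean equal points, which disjointness of
      the hypersurfaces excludes.\<close>
    have "inj_on (\<lambda>j. z j (\<alpha>, \<beta>)) {1..d}"
    proof (rule inj_onI)
      fix i j assume ij: "i \<in> {1..d}" "j \<in> {1..d}" "z i (\<alpha>, \<beta>) = z j (\<alpha>, \<beta>)"
      then have "p i \<alpha> \<beta> = p j \<alpha> \<beta>" using p_line[OF ab] by metis
      then have "p i \<alpha> \<beta> \<in> \<gamma> i \<inter> \<gamma> j" using inter(1)[OF ab] ij by blast
      then show "i = j" using disjoint ij(1,2) unfolding disjoint_family_on_def by blast
    qed
    moreover have "(\<Sum>m\<le>d. F m (z j (\<alpha>, \<beta>) *s vjoin \<alpha> 1 + vjoin \<beta> 0)) = 0" if j: "j \<in> {1..d}" for j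
    proof -
      let ?t = "z j (\<alpha>, \<beta>)"
      let ?b = "?t *s \<alpha> + \<beta>"
      have "cmod ?t < M" using \<epsilon>1(2)[of \<alpha> \<beta>] \<alpha> \<beta> \<epsilon>0 j by auto
      then have "norm (?t *s \<alpha>) \<le> M * \<epsilon>0"
        unfolding norm_smult_vec using \<alpha> M by (intro mult_mono) auto
      then have b: "norm ?b < \<epsilon>"
        using norm_triangle_ineq[of "?t *s \<alpha>" \<beta>] \<beta> \<epsilon>0_M by (simp add: algebra_simps)
      have p: "p j \<alpha> \<beta> = vjoin ?b ?t" by (rule p_line[OF ab j])
      have "vjoin ?b ?t \<in> affine_line 0 ?b" by (simp add: mem_affine_line_iff)
      moreover have "vjoin ?b ?t \<in> \<gamma> j" using inter(1)[OF ab j] p by auto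
      moreover have "affine_line 0 ?b \<inter> \<gamma> j = {p j 0 ?b}" using \<epsilon> b j by (intro inter(1)) auto
      ultimately have "vjoin ?b ?t \<in> {p j 0 ?b}" by (metis IntI)
      then have "p j 0 ?b = vjoin ?b ?t" by simp
      then have "z j (0, ?b) = ?t" by (simp add: z_def)
      then have "(\<Prod>i\<in>{1..d}. ?t - z i (0, ?b)) = 0" using j by (intro prod_zero bexI[of _ j]) auto
      then show ?thesis using sum_F[OF b, of ?t] by (simp only: line)
    qed
    ultimately show ?thesis unfolding P line by (intro sum_hforms_line F)
  qed
  have lc: "cmod (F d (vjoin \<alpha> 1)) > 1 / 2" if "norm \<alpha> < \<epsilon>0" for \<alpha> :: "complex ^ 'm"
    using \<epsilon>2(2) that \<epsilon>0 by auto

  \<comment> \<open>Growth estimate and zero set\<close>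
  show ?thesis
  proof (intro exI conjI)
    show "cpoly_degree P = d + D" using P(2) D0 by simp
    show "\<epsilon>0 > 0" by (rule \<epsilon>0_pos)
    \<comment> \<open>The factor 1/2 bounds the leading coefficient on the line. From
      \<open>norm \<zeta> \<le> 2 * cmod t + 1\<close> and roots below \<open>M\<close>, each linear
      factor is at least \<open>norm \<zeta> / 4\<close> once
      \<open>norm \<zeta> \<ge> 4 * M + 2\<close>.\<close>
    show "(1 / 2) * (1 / 4) ^ d > (0 :: real)" by simp
    show "4 * M + 2 > 0" using M by simp
    show "\<forall>\<zeta>\<in>line_tube \<epsilon>0. 4 * M + 2 \<le> norm \<zeta> \<longrightarrow>
        (1 / 2) * (1 / 4) ^ d * norm \<zeta> ^ d \<le> cmod (cpoly_eval P \<zeta>)"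
    proof (intro ballI impI)
      fix \<zeta> :: "complex ^ 'm option" assume "\<zeta> \<in> line_tube \<epsilon>0" and large: "4 * M + 2 \<le> norm \<zeta>"
      then obtain \<alpha> \<beta> :: "complex ^ 'm" where ab: "norm \<alpha> < \<epsilon>0" "norm \<beta> < \<epsilon>0" and l: "\<zeta> \<in> affine_line \<alpha> \<beta>"
        by (auto simp: line_tube_def)
      define t where "t = \<zeta> $ None"
      have \<zeta>: "\<zeta> = vjoin (t *s \<alpha> + \<beta>) t" using l by (simp add: mem_affine_line_iff t_def)
      have "norm \<zeta> \<le> norm (t *s \<alpha> + \<beta>) + cmod t" unfolding \<zeta> by (rule norm_vjoin_le)
      also have "\<dots> \<le> cmod t * norm \<alpha> + norm \<beta> + cmod t"
        using norm_triangle_ineq[of "t *s \<alpha>" \<beta>] by (simp add: norm_smult_vec)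
      also have "\<dots> \<le> cmod t * 1 + 1 + cmod t"
        using ab \<epsilon>0 by (intro add_mono mult_left_mono) auto
      finally have t: "norm \<zeta> \<le> 2 * cmod t + 1" by simp
      have "(norm \<zeta> / 4) ^ d = (\<Prod>j\<in>{1..d}. norm \<zeta> / 4)" by simp
      also have "\<dots> \<le> (\<Prod>j\<in>{1..d}. cmod (t - z j (\<alpha>, \<beta>)))"
      proof (rule prod_mono, intro conjI)
        fix j assume "j \<in> {1..d}"
        then have "cmod (z j (\<alpha>, \<beta>)) < M" using \<epsilon>1(2)[of \<alpha> \<beta>] ab \<epsilon>0 by auto
        then show "norm \<zeta> / 4 \<le> cmod (t - z j (\<alpha>, \<beta>))"
          using norm_triangle_ineq2[of t "z j (\<alpha>, \<beta>)"] t large by linarith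
      qed simp
      finally have "(norm \<zeta> / 4) ^ d \<le> cmod (\<Prod>j\<in>{1..d}. t - z j (\<alpha>, \<beta>))" by (simp add: prod_norm)
      then have "(1 / 2) * (norm \<zeta> / 4) ^ d \<le> cmod (F d (vjoin \<alpha> 1)) * cmod (\<Prod>j\<in>{1..d}. t - z j (\<alpha>, \<beta>))"
        using lc[OF ab(1)] by (intro mult_mono) auto
      also have "\<dots> = cmod (cpoly_eval P \<zeta>)" using factor[OF ab, of t] by (simp add: \<zeta> norm_mult)
      finally show "(1 / 2) * (1 / 4) ^ d * norm \<zeta> ^ d \<le> cmod (cpoly_eval P \<zeta>)"
        by (simp add: power_divide)
    qed
    show "\<forall>\<alpha> \<beta>. max (norm \<alpha>) (norm \<beta>) < \<epsilon>0 \<longrightarrow>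
        affine_line \<alpha> \<beta> \<inter> zero_set P = (\<lambda>j. p j \<alpha> \<beta>) ` {1..d}"
    proof (intro allI impI)
      fix \<alpha> \<beta> :: "complex ^ 'm" assume "max (norm \<alpha>) (norm \<beta>) < \<epsilon>0"
      then have ab: "norm \<alpha> < \<epsilon>0" "norm \<beta> < \<epsilon>0" by auto
      then have ab': "norm \<alpha> < \<epsilon>" "norm \<beta> < \<epsilon>" using \<epsilon>0 by auto
      have "F d (vjoin \<alpha> 1) \<noteq> 0" using lc[OF ab(1)] by auto
      then have zero: "vjoin (t *s \<alpha> + \<beta>) t \<in> zero_set P \<longleftrightarrow> (\<exists>j\<in>{1..d}. t = z j (\<alpha>, \<beta>))" for t
        by (simp add: zero_set_def factor[OF ab])
      show "affine_line \<alpha> \<beta> \<inter> zero_set P = (\<lambda>j. p j \<alpha> \<beta>) ` {1..d}"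
      proof (intro equalityI subsetI)
        fix \<zeta> assume "\<zeta> \<in> affine_line \<alpha> \<beta> \<inter> zero_set P"
        then have \<zeta>: "\<zeta> = vjoin (\<zeta> $ None *s \<alpha> + \<beta>) (\<zeta> $ None)" "\<zeta> \<in> zero_set P"
          by (auto simp flip: mem_affine_line_iff)
        then obtain j where j: "j \<in> {1..d}" "\<zeta> $ None = z j (\<alpha>, \<beta>)" using zero by metis
        then have "\<zeta> = p j \<alpha> \<beta>" using \<zeta>(1) p_line[OF ab' j(1)] by metis
        then show "\<zeta> \<in> (\<lambda>j. p j \<alpha> \<beta>) ` {1..d}" using j(1) by blast
      next
        fix \<zeta> assume "\<zeta> \<in> (\<lambda>j. p j \<alpha> \<beta>) ` {1..d}"
        then obtain j where j: "j \<in> {1..d}" "\<zeta> = p j \<alpha> \<beta>" by blast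
        then have "\<zeta> \<in> affine_line \<alpha> \<beta>" using inter(1)[OF ab' j(1)] by auto
        moreover have "\<zeta> \<in> zero_set P" using zero p_line[OF ab' j(1)] j by metis
        ultimately show "\<zeta> \<in> affine_line \<alpha> \<beta> \<inter> zero_set P" by blast
      qed
    qed
  qed
qed

end
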